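(* Let $F(X_1,\ldots,X_n):=\sum_{k=0}^\infty\sum_{|\alpha|=k}X_\alpha\otimes A_{(\alpha)}$, $A_{(\alpha)}\in B(\mathcal{H})$, be a (universal) holomorphic function on $[B(\mathcal{X})^n]_{<1}$ with coefficients in $B(\mathcal{H})$ such that $F(0)\geq0$ and $$\mathrm{Re}\,F(X_1,\ldots,X_n)\leq I\quad\text{for any }(X_1,\ldots,X_n)\in[B(\mathcal{X})^n]_{<1}\text{ and any Hilbert space }\mathcal{X}.$$ Then $$\sum_{k=0}^\infty\left\|\sum_{|\alpha|=k}T_\alpha\otimes A_{(\alpha)}\right\|\leq\|A_{(0)}\|+\|I-A_{(0)}\|$$ for any $(T_1,\ldots,T_n)\in[B(\mathcal{K})^n]_{1/3}$ and any Hilbert space $\mathcal{K}$.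
   Context: $\mathbb{F}_n^+$ is the unital free semigroup on $g_1,\dots,g_n$ with identity $g_0$; $|g_{i_1}\cdots g_{i_k}|=k$, $|g_0|=0$; for $\alpha=g_{i_1}\cdots g_{i_k}$, $X_\alpha:=X_{i_1}\cdots X_{i_k}$, $X_{g_0}:=I$. $[B(\mathcal{X})^n]_{<1}:=\{(X_1,\ldots,X_n)\in B(\mathcal{X})^n:\|X_1X_1^*+\cdots+X_nX_n^*\|<1\}$ and $[B(\mathcal{K})^n]_r:=\{(T_1,\ldots,T_n):\|T_1T_1^*+\cdots+T_nT_n^*\|^{1/2}\le r\}$. A family $\{A_{(\alpha)}\}_{\alpha\in\mathbb{F}_n^+}\subset B(\mathcal{H})$ ($\mathcal{H}$ a Hilbert space) defines a (universal) holomorphic function $F$ on $[B(\mathcal{X})^n]_{<1}$ with coefficients in $B(\mathcal{H})$ if $\sum_{k=0}^\infty\left(\sum_{|\alpha|=k}X_\alpha\otimes A_{(\alpha)}\right)$ converges in operator norm for every Hilbert space $\mathcal{X}$ and every $(X_1,\ldots,X_n)\in[B(\mathcal{X})^n]_{<1}$. $A_{(0)}:=A_{(g_0)}$; $F(0)\ge0$ means $A_{(0)}\ge0$; $\mathrm{Re}\,A=\frac12(A+A^* )$. *)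

theory Defs
  imports "HOL-Analysis.Analysis" "HOL-Algebra.Module"
begin

section \<open>Complex Hilbert spaces with explicit carriers\<close>

text \<open>
  The theorem quantifies over all Hilbert spaces inside its hypotheses, and HOL has no
  quantification over types within a formula.  A Hilbert space is therefore a structure whose
  carrier is a subset of a type, and ``every Hilbert space'' ranges over all such structures on
  all subsets of a type \<open>'u\<close> that is itself arbitrary and plays the role of a universe.

  The vector space part is a module in the sense of HOL-Algebra, so the record has a ring
  multiplication and a ring unit as well; these two fields are irrelevant for Hilbert spaces.
\<close>

definition complex_ring :: "complex ring" where
  "complex_ring = \<lparr>carrier = UNIV, mult = (*), one = 1, zero = 0, add = (+)\<rparr>"

record 'a hilbert = "(complex, 'a) module" +
  hinner :: "'a \<Rightarrow> 'a \<Rightarrow> complex"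

definition hnorm :: "'a hilbert \<Rightarrow> 'a \<Rightarrow> real" where
  "hnorm X x = sqrt (Re (hinner X x x))"

locale hilbert_space = module complex_ring X for X :: "'a hilbert" (structure) +
  assumes hinner_add_left:
      "\<lbrakk>x \<in> carrier X; y \<in> carrier X; z \<in> carrier X\<rbrakk>
        \<Longrightarrow> hinner X (x \<oplus> y) z = hinner X x z + hinner X y z"
    and hinner_smult_left:
      "\<lbrakk>x \<in> carrier X; y \<in> carrier X\<rbrakk> \<Longrightarrow> hinner X (c \<odot> x) y = c * hinner X x y"
    and hinner_commute:
      "\<lbrakk>x \<in> carrier X; y \<in> carrier X\<rbrakk> \<Longrightarrow> hinner X x y = cnj (hinner X y x)"
    and hinner_nonneg: "x \<in> carrier X \<Longrightarrow> 0 \<le> Re (hinner X x x)"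
    and hinner_definite: "\<lbrakk>x \<in> carrier X; hinner X x x = 0\<rbrakk> \<Longrightarrow> x = \<zero>"
    and complete:
      "\<lbrakk>range s \<subseteq> carrier X; \<forall>e>0. \<exists>N. \<forall>i\<ge>N. \<forall>j\<ge>N. hnorm X (s i \<ominus> s j) < e\<rbrakk>
        \<Longrightarrow> \<exists>l\<in>carrier X. (\<lambda>i. hnorm X (s i \<ominus> l)) \<longlonglongrightarrow> 0"


section \<open>Bounded operators\<close>

text \<open>
  Operators are extensional functions (\<open>undefined\<close> outside the carrier), so that two operators
  are equal iff they agree on the carrier.
\<close>

definition BO :: "'a hilbert \<Rightarrow> (complex, 'a \<Rightarrow> 'a) module" where
  "BO X =
    \<lparr>carrier = {T \<in> carrier X \<rightarrow>\<^sub>E carrier X.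
        (\<forall>x\<in>carrier X. \<forall>y\<in>carrier X. T (x \<oplus>\<^bsub>X\<^esub> y) = T x \<oplus>\<^bsub>X\<^esub> T y) \<and>
        (\<forall>c. \<forall>x\<in>carrier X. T (c \<odot>\<^bsub>X\<^esub> x) = c \<odot>\<^bsub>X\<^esub> T x) \<and>
        (\<exists>C. \<forall>x\<in>carrier X. hnorm X (T x) \<le> C * hnorm X x)},
     mult = compose (carrier X),
     one = (\<lambda>x\<in>carrier X. x),
     zero = (\<lambda>x\<in>carrier X. \<zero>\<^bsub>X\<^esub>),
     add = (\<lambda>S T. \<lambda>x\<in>carrier X. S x \<oplus>\<^bsub>X\<^esub> T x),
     smult = (\<lambda>c T. \<lambda>x\<in>carrier X. c \<odot>\<^bsub>X\<^esub> T x)\<rparr>"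

definition opnorm :: "'a hilbert \<Rightarrow> ('a \<Rightarrow> 'a) \<Rightarrow> real" where
  "opnorm X T = Sup {hnorm X (T x) | x. x \<in> carrier X \<and> hnorm X x \<le> 1}"

definition adj :: "'a hilbert \<Rightarrow> ('a \<Rightarrow> 'a) \<Rightarrow> ('a \<Rightarrow> 'a)" where
  "adj X T = (THE S. S \<in> carrier (BO X) \<and>
     (\<forall>x\<in>carrier X. \<forall>y\<in>carrier X. hinner X (T x) y = hinner X x (S y)))"

definition re_op :: "'a hilbert \<Rightarrow> ('a \<Rightarrow> 'a) \<Rightarrow> ('a \<Rightarrow> 'a)" where
  "re_op X T = (1 / 2) \<odot>\<^bsub>BO X\<^esub> (T \<oplus>\<^bsub>BO X\<^esub> adj X T)"

definition op_le :: "'a hilbert \<Rightarrow> ('a \<Rightarrow> 'a) \<Rightarrow> ('a \<Rightarrow> 'a) \<Rightarrow> bool" where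
  "op_le X S T \<longleftrightarrow> (\<forall>x\<in>carrier X.
     Im (hinner X ((T \<ominus>\<^bsub>BO X\<^esub> S) x) x) = 0 \<and> 0 \<le> Re (hinner X ((T \<ominus>\<^bsub>BO X\<^esub> S) x) x))"

definition op_sums :: "'a hilbert \<Rightarrow> (nat \<Rightarrow> 'a \<Rightarrow> 'a) \<Rightarrow> ('a \<Rightarrow> 'a) \<Rightarrow> bool" where
  "op_sums X f S \<longleftrightarrow> S \<in> carrier (BO X) \<and>
     (\<lambda>N. opnorm X ((\<Oplus>\<^bsub>BO X\<^esub>k\<in>{..<N}. f k) \<ominus>\<^bsub>BO X\<^esub> S)) \<longlonglongrightarrow> 0"


section \<open>Row balls\<close>

definition row_square :: "nat \<Rightarrow> 'a hilbert \<Rightarrow> (nat \<Rightarrow> 'a \<Rightarrow> 'a) \<Rightarrow> ('a \<Rightarrow> 'a)" where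
  "row_square n X T = (\<Oplus>\<^bsub>BO X\<^esub>i\<in>{1..n}. T i \<otimes>\<^bsub>BO X\<^esub> adj X (T i))"

definition open_row_ball :: "nat \<Rightarrow> 'a hilbert \<Rightarrow> (nat \<Rightarrow> 'a \<Rightarrow> 'a) set" where
  "open_row_ball n X = {T \<in> {1..n} \<rightarrow> carrier (BO X). opnorm X (row_square n X T) < 1}"

definition closed_row_ball :: "nat \<Rightarrow> 'a hilbert \<Rightarrow> real \<Rightarrow> (nat \<Rightarrow> 'a \<Rightarrow> 'a) set" where
  "closed_row_ball n X r =
     {T \<in> {1..n} \<rightarrow> carrier (BO X). sqrt (opnorm X (row_square n X T)) \<le> r}"


section \<open>Hilbert space tensor products\<close>

text \<open>
  \<open>Z\<close> together with the bilinear map \<open>t\<close> is a Hilbert tensor product of \<open>X\<close> and \<open>H\<close> if inner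
  products of elementary tensors \<open>t x h\<close> multiply and the finite sums of elementary tensors
  (that is, the algebraic tensor product) are dense.  This determines \<open>(Z, t)\<close> up to a unique
  unitary that respects elementary tensors.
\<close>

locale hilbert_tensor =
  X: hilbert_space X + H: hilbert_space H + Z: hilbert_space Z
  for X :: "'a hilbert" and H :: "'b hilbert" and Z :: "'c hilbert"
    and t :: "'a \<Rightarrow> 'b \<Rightarrow> 'c" +
  assumes tensor_closed: "\<lbrakk>x \<in> carrier X; h \<in> carrier H\<rbrakk> \<Longrightarrow> t x h \<in> carrier Z"
    and tensor_add_left:
      "\<lbrakk>x \<in> carrier X; y \<in> carrier X; h \<in> carrier H\<rbrakk>
        \<Longrightarrow> t (x \<oplus>\<^bsub>X\<^esub> y) h = t x h \<oplus>\<^bsub>Z\<^esub> t y h"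
    and tensor_add_right:
      "\<lbrakk>x \<in> carrier X; h \<in> carrier H; k \<in> carrier H\<rbrakk>
        \<Longrightarrow> t x (h \<oplus>\<^bsub>H\<^esub> k) = t x h \<oplus>\<^bsub>Z\<^esub> t x k"
    and tensor_smult_left:
      "\<lbrakk>x \<in> carrier X; h \<in> carrier H\<rbrakk> \<Longrightarrow> t (c \<odot>\<^bsub>X\<^esub> x) h = c \<odot>\<^bsub>Z\<^esub> t x h"
    and tensor_smult_right:
      "\<lbrakk>x \<in> carrier X; h \<in> carrier H\<rbrakk> \<Longrightarrow> t x (c \<odot>\<^bsub>H\<^esub> h) = c \<odot>\<^bsub>Z\<^esub> t x h"
    and hinner_tensor:
      "\<lbrakk>x \<in> carrier X; h \<in> carrier H; y \<in> carrier X; k \<in> carrier H\<rbrakk>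
        \<Longrightarrow> hinner Z (t x h) (t y k) = hinner X x y * hinner H h k"
    and tensor_dense:
      "\<lbrakk>z \<in> carrier Z; 0 < e\<rbrakk>
        \<Longrightarrow> \<exists>P. finite P \<and> P \<subseteq> carrier X \<times> carrier H \<and>
              hnorm Z (z \<ominus>\<^bsub>Z\<^esub> (\<Oplus>\<^bsub>Z\<^esub>p\<in>P. t (fst p) (snd p))) < e"

text \<open>
  For \<open>X\<close> on the type \<open>'u\<close> and \<open>H\<close> on the type \<open>'h\<close>, a tensor product always has a realization
  on the type below: the Hilbert space of functions on \<open>carrier X \<times> carrier H\<close> (extended by \<open>0\<close>)
  with reproducing kernel \<open>hinner X x y * hinner H h k\<close>, where \<open>t x h\<close> is the function
  \<open>(y, k) \<mapsto> hinner X x y * hinner H h k\<close>.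
\<close>

type_synonym ('u, 'h) tensor_carrier = "'u \<times> 'h \<Rightarrow> complex"

definition tensor_op ::
  "'a hilbert \<Rightarrow> 'b hilbert \<Rightarrow> 'c hilbert \<Rightarrow> ('a \<Rightarrow> 'b \<Rightarrow> 'c)
    \<Rightarrow> ('a \<Rightarrow> 'a) \<Rightarrow> ('b \<Rightarrow> 'b) \<Rightarrow> ('c \<Rightarrow> 'c)" where
  "tensor_op X H Z t S T = (THE B. B \<in> carrier (BO Z) \<and>
     (\<forall>x\<in>carrier X. \<forall>h\<in>carrier H. B (t x h) = t (S x) (T h)))"


section \<open>Free holomorphic functions\<close>

text \<open>
  The word \<open>g\<^sub>i\<^sub>1 \<dots> g\<^sub>i\<^sub>k\<close> of the free semigroup on \<open>n\<close> generators is the list of its indices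
  in \<open>{1..n}\<close>; the identity \<open>g\<^sub>0\<close> is the empty list.
\<close>

definition words :: "nat \<Rightarrow> nat \<Rightarrow> nat list set" where
  "words n k = {\<alpha> \<in> lists {1..n}. length \<alpha> = k}"

definition word_op :: "'a hilbert \<Rightarrow> (nat \<Rightarrow> 'a \<Rightarrow> 'a) \<Rightarrow> nat list \<Rightarrow> ('a \<Rightarrow> 'a)" where
  "word_op X T \<alpha> = foldr (\<lambda>i S. T i \<otimes>\<^bsub>BO X\<^esub> S) \<alpha> \<one>\<^bsub>BO X\<^esub>"

definition hom_part ::
  "nat \<Rightarrow> 'a hilbert \<Rightarrow> 'b hilbert \<Rightarrow> 'c hilbert \<Rightarrow> ('a \<Rightarrow> 'b \<Rightarrow> 'c)
    \<Rightarrow> (nat list \<Rightarrow> 'b \<Rightarrow> 'b) \<Rightarrow> (nat \<Rightarrow> 'a \<Rightarrow> 'a) \<Rightarrow> nat \<Rightarrow> ('c \<Rightarrow> 'c)" where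
  "hom_part n X H Z t A T k =
     (\<Oplus>\<^bsub>BO Z\<^esub>\<alpha>\<in>words n k. tensor_op X H Z t (word_op X T \<alpha>) (A \<alpha>))"

definition nc_value ::
  "nat \<Rightarrow> 'a hilbert \<Rightarrow> 'b hilbert \<Rightarrow> 'c hilbert \<Rightarrow> ('a \<Rightarrow> 'b \<Rightarrow> 'c)
    \<Rightarrow> (nat list \<Rightarrow> 'b \<Rightarrow> 'b) \<Rightarrow> (nat \<Rightarrow> 'a \<Rightarrow> 'a) \<Rightarrow> ('c \<Rightarrow> 'c)" where
  "nc_value n X H Z t A T = (THE S. op_sums Z (hom_part n X H Z t A T) S)"

definition universal_holomorphic ::
  "'u itself \<Rightarrow> nat \<Rightarrow> 'h hilbert \<Rightarrow> (nat list \<Rightarrow> 'h \<Rightarrow> 'h) \<Rightarrow> bool" where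
  "universal_holomorphic U n H A \<longleftrightarrow>
     (\<forall>\<alpha>\<in>lists {1..n}. A \<alpha> \<in> carrier (BO H)) \<and>
     (\<forall>(X :: 'u hilbert) (Z :: ('u, 'h) tensor_carrier hilbert) t T.
        hilbert_tensor X H Z t \<and> T \<in> open_row_ball n X \<longrightarrow>
        (\<exists>S. op_sums Z (hom_part n X H Z t A T) S))"

end

theory Submission
  imports Defs
begin

text \<open>
  Fix \<open>T\<close> in the closed row ball of radius \<open>1/3\<close> and let \<open>P\<^sub>k\<close> be the homogeneous parts
  of \<open>F\<close> at \<open>T\<close>.  For \<open>\<bar>z\<bar> < 1\<close> the point \<open>3zT\<close> lies in the open row ball, so
  \<open>I - F(3zT) = (I - P\<^sub>0) - \<Sum>\<^sub>k\<^sub>\<ge>\<^sub>1 (3z)\<^sup>k P\<^sub>k\<close> is a one-variable operator-valued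
  power series with positive real part.  By a Caratheodory type inequality,
  \<open>3\<^sup>k \<parallel>P\<^sub>k\<parallel> \<le> 2 \<parallel>I - P\<^sub>0\<parallel>\<close> for \<open>k \<ge> 1\<close>.  Since \<open>P\<^sub>0 = I \<otimes> A\<^sub>0\<close>, summing the
  geometric series with ratio \<open>1/3\<close> gives the constant \<open>2 (1/3) / (1 - 1/3) = 1\<close> in front of
  \<open>\<parallel>I - A\<^sub>0\<parallel>\<close>.
\<close>

section \<open>Hilbert space geometry\<close>

text \<open>\<open>adj\<close>, \<open>tensor_op\<close> and \<open>nc_value\<close> are definite
  descriptions, so each needs existence and uniqueness before it says anything. The hard case is S
  \<otimes> T: a vector of the algebraic tensor product has many representations, so the bound
  \<parallel>S \<otimes> T\<parallel> \<le> \<parallel>S\<parallel> \<parallel>T\<parallel> on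
  finite sums is needed even for well-definedness. It is obtained without orthonormal bases or
  square roots of operators. The same bound controls I - P_0 = I \<otimes> (I - A_0) by the norm of
  I - A_0 alone. The Caratheodory inequality has to bound the operator norm of a coefficient by the
  quadratic form of the constant term. Herglotz representations and operator-valued integrals are
  avoided: series are tested in matrix coefficients <P_k x, y>, and integrals over the circle become
  means over roots of unity, so only scalar power series on circles of radius below 1 occur.\<close>

lemma carrier_complex_ring [simp]: "carrier complex_ring = UNIV"
  and mult_complex_ring [simp]: "mult complex_ring = (*)"
  and add_complex_ring [simp]: "add complex_ring = (+)"
  and one_complex_ring [simp]: "one complex_ring = 1"
  and zero_complex_ring [simp]: "zero complex_ring = 0"
  by (simp_all add: complex_ring_def)

context hilbert_space
begin

lemmas smult_in [simp, intro] = smult_closed [simplified]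

lemma hinner_add_right:
  assumes "x \<in> carrier X" "y \<in> carrier X" "z \<in> carrier X"
  shows "hinner X z (x \<oplus> y) = hinner X z x + hinner X z y"
  using assms by (metis M.add.m_closed complex_cnj_add hinner_add_left hinner_commute)

lemma hinner_smult_right:
  assumes "x \<in> carrier X" "y \<in> carrier X"
  shows "hinner X x (c \<odot> y) = cnj c * hinner X x y"
  using assms by (metis smult_in complex_cnj_mult hinner_smult_left hinner_commute)

lemma hinner_zero_left [simp]: "x \<in> carrier X \<Longrightarrow> hinner X \<zero> x = 0"
  using hinner_add_left [of \<zero> \<zero> x] by simp

lemma hinner_zero_right [simp]: "x \<in> carrier X \<Longrightarrow> hinner X x \<zero> = 0"
  using hinner_add_right [of \<zero> \<zero> x] by simp

lemma hinner_uminus_left: "x \<in> carrier X \<Longrightarrow> y \<in> carrier X \<Longrightarrow> hinner X (\<ominus> x) y = - hinner X x y"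
  using hinner_add_left [of x "\<ominus> x" y] by (simp add: M.r_neg add_eq_0_iff)

lemma hinner_uminus_right: "x \<in> carrier X \<Longrightarrow> y \<in> carrier X \<Longrightarrow> hinner X y (\<ominus> x) = - hinner X y x"
  using hinner_add_right [of x "\<ominus> x" y] by (simp add: M.r_neg add_eq_0_iff)

lemma hinner_minus_left:
  "\<lbrakk>x \<in> carrier X; y \<in> carrier X; z \<in> carrier X\<rbrakk> \<Longrightarrow> hinner X (x \<ominus> y) z = hinner X x z - hinner X y z"
  by (simp add: M.minus_eq hinner_add_left hinner_uminus_left)

lemma hinner_minus_right:
  "\<lbrakk>x \<in> carrier X; y \<in> carrier X; z \<in> carrier X\<rbrakk> \<Longrightarrow> hinner X z (x \<ominus> y) = hinner X z x - hinner X z y"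
  by (simp add: M.minus_eq hinner_add_right hinner_uminus_right)

lemmas hinner_simps =
  hinner_add_left hinner_add_right hinner_smult_left hinner_smult_right
  hinner_uminus_left hinner_uminus_right hinner_minus_left hinner_minus_right

text \<open>Reduces vector identities to scalar identities, which \<open>hinner_simps\<close> and
  ring arithmetic settle; most later module computations are done this way.\<close>

lemma hinner_ext:
  assumes "x \<in> carrier X" "y \<in> carrier X" "\<And>z. z \<in> carrier X \<Longrightarrow> hinner X x z = hinner X y z"
  shows "x = y"
proof -
  have "hinner X (x \<ominus> y) (x \<ominus> y) = 0"
    using assms by (simp add: hinner_minus_left)
  then have "x \<ominus> y = \<zero>"
    using assms by (intro hinner_definite) auto
  then have "\<ominus> (\<ominus> y) = x"
    using assms by (intro M.minus_equality) (simp_all add: M.minus_eq)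
  then show ?thesis using assms by simp
qed

lemma hinner_self: "x \<in> carrier X \<Longrightarrow> hinner X x x = of_real ((hnorm X x)\<^sup>2)"
  using hinner_commute [of x x] hinner_nonneg [of x]
  by (simp add: hnorm_def complex_eq_iff)

lemma Re_hinner_self: "x \<in> carrier X \<Longrightarrow> Re (hinner X x x) = (hnorm X x)\<^sup>2"
  by (simp add: hinner_self)

lemma hnorm_nonneg [simp]: "x \<in> carrier X \<Longrightarrow> 0 \<le> hnorm X x"
  by (simp add: hnorm_def hinner_nonneg)

lemma hnorm_zero [simp]: "hnorm X \<zero> = 0"
  by (simp add: hnorm_def)

lemma hnorm_eq_0_iff: "x \<in> carrier X \<Longrightarrow> hnorm X x = 0 \<longleftrightarrow> x = \<zero>"
  using hinner_definite [of x] by (auto simp: hinner_self)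

lemma hnorm_le_0_iff: "x \<in> carrier X \<Longrightarrow> hnorm X x \<le> 0 \<longleftrightarrow> x = \<zero>"
  by (metis antisym hnorm_eq_0_iff hnorm_nonneg order_refl)

lemma hnorm_smult: "x \<in> carrier X \<Longrightarrow> hnorm X (c \<odot> x) = cmod c * hnorm X x"
proof -
  assume x: "x \<in> carrier X"
  have "c * cnj c = of_real ((cmod c)\<^sup>2)"
    by (rule complex_norm_square [symmetric])
  then have "hinner X (c \<odot> x) (c \<odot> x) = of_real ((cmod c * hnorm X x)\<^sup>2)"
    using x by (simp add: hinner_smult_left hinner_smult_right hinner_self [OF x]
        power_mult_distrib mult.commute [of "cnj c" c] flip: mult.assoc)
  then show ?thesis
    using x by (simp add: hnorm_def hinner_nonneg)
qed

lemma hnorm_minus_commute: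
  "x \<in> carrier X \<Longrightarrow> y \<in> carrier X \<Longrightarrow> hnorm X (x \<ominus> y) = hnorm X (y \<ominus> x)"
  by (simp add: hnorm_def hinner_simps algebra_simps)

lemma Cauchy_Schwarz:
  assumes x: "x \<in> carrier X" and y: "y \<in> carrier X"
  shows "cmod (hinner X x y) \<le> hnorm X x * hnorm X y"
proof (cases "hnorm X y = 0")
  case True
  then show ?thesis using x y by (simp add: hnorm_eq_0_iff)
next
  case False
  \<comment> \<open>\<open>c \<odot> y\<close> is the orthogonal projection of \<open>x\<close> onto
    the line through \<open>y\<close>; the inequality is nonnegativity of the squared norm of the
    remainder.\<close>
  define c where "c = hinner X x y / of_real ((hnorm X y)\<^sup>2)"
  define a where "a = hinner X x y"
  have yx: "hinner X y x = cnj a" using x y hinner_commute a_def by blast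
  have aa: "a * cnj a = of_real ((cmod a)\<^sup>2)" by (rule complex_norm_square [symmetric])
  have c: "c = a / of_real ((hnorm X y)\<^sup>2)" by (simp add: c_def a_def)
  have "hinner X (x \<ominus> c \<odot> y) (x \<ominus> c \<odot> y)
      = of_real ((hnorm X x)\<^sup>2) - cnj c * a - c * cnj a + c * cnj c * of_real ((hnorm X y)\<^sup>2)"
    using x y by (simp add: hinner_simps hinner_self [OF x] hinner_self [OF y] yx algebra_simps
        flip: a_def)
  also have "\<dots> = of_real ((hnorm X x)\<^sup>2) - a * cnj a / of_real ((hnorm X y)\<^sup>2)"
    using False by (simp add: c field_simps power2_eq_square)
  also have "\<dots> = of_real ((hnorm X x)\<^sup>2 - (cmod a)\<^sup>2 / (hnorm X y)\<^sup>2)"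
    by (simp only: aa of_real_diff of_real_divide)
  finally have "0 \<le> (hnorm X x)\<^sup>2 - (cmod a)\<^sup>2 / (hnorm X y)\<^sup>2"
    using hinner_nonneg [of "x \<ominus> c \<odot> y"] x y by simp
  then have "(cmod a)\<^sup>2 \<le> (hnorm X x * hnorm X y)\<^sup>2"
    using False by (simp add: field_simps power_mult_distrib)
  then show ?thesis
    using x y by (simp add: a_def power2_le_iff_abs_le)
qed

lemma hnorm_triangle:
  assumes x: "x \<in> carrier X" and y: "y \<in> carrier X"
  shows "hnorm X (x \<oplus> y) \<le> hnorm X x + hnorm X y"
proof -
  have "(hnorm X (x \<oplus> y))\<^sup>2 = (hnorm X x)\<^sup>2 + (hnorm X y)\<^sup>2 + 2 * Re (hinner X x y)"
    using x y hinner_commute [of y x]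
    by (simp add: hinner_simps flip: Re_hinner_self)
  also have "\<dots> \<le> (hnorm X x + hnorm X y)\<^sup>2"
    using Cauchy_Schwarz [OF x y] complex_Re_le_cmod [of "hinner X x y"]
    by (simp add: power2_sum)
  finally show ?thesis
    using x y by (simp add: power2_le_iff_abs_le)
qed

lemma hnorm_triangle_minus:
  assumes x: "x \<in> carrier X" and y: "y \<in> carrier X" and z: "z \<in> carrier X"
  shows "hnorm X (x \<ominus> z) \<le> hnorm X (x \<ominus> y) + hnorm X (y \<ominus> z)"
proof -
  have "x \<ominus> z = (x \<ominus> y) \<oplus> (y \<ominus> z)"
    using assms by (intro hinner_ext) (auto simp: hinner_simps)
  then show ?thesis
    using hnorm_triangle [of "x \<ominus> y" "y \<ominus> z"] assms by simp
qed

lemma hnorm_le_add_minus: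
  assumes x: "x \<in> carrier X" and y: "y \<in> carrier X"
  shows "hnorm X x \<le> hnorm X y + hnorm X (x \<ominus> y)"
proof -
  have "x = y \<oplus> (x \<ominus> y)"
    using assms by (intro hinner_ext) (auto simp: hinner_simps)
  then show ?thesis
    using hnorm_triangle [of y "x \<ominus> y"] assms by simp
qed

lemma abs_hnorm_diff_le:
  assumes x: "x \<in> carrier X" and y: "y \<in> carrier X"
  shows "\<bar>hnorm X x - hnorm X y\<bar> \<le> hnorm X (x \<ominus> y)"
  using hnorm_le_add_minus [OF x y] hnorm_le_add_minus [OF y x] hnorm_minus_commute [OF x y] by simp

lemma hnorm_tendsto:
  assumes "range s \<subseteq> carrier X" "l \<in> carrier X" "(\<lambda>i. hnorm X (s i \<ominus> l)) \<longlonglongrightarrow> 0"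
  shows "(\<lambda>i. hnorm X (s i)) \<longlonglongrightarrow> hnorm X l"
proof -
  have "(\<lambda>i. hnorm X (s i) - hnorm X l) \<longlonglongrightarrow> 0"
    by (rule Lim_null_comparison [OF _ assms(3)])
       (use assms in \<open>auto simp: image_subset_iff intro!: always_eventually abs_hnorm_diff_le\<close>)
  then show ?thesis by (simp add: LIM_zero_iff)
qed

lemma hinner_tendsto:
  assumes "range s \<subseteq> carrier X" "l \<in> carrier X" "(\<lambda>i. hnorm X (s i \<ominus> l)) \<longlonglongrightarrow> 0"
    and v: "v \<in> carrier X"
  shows "(\<lambda>i. hinner X (s i) v) \<longlonglongrightarrow> hinner X l v"
proof -
  have "(\<lambda>i. hnorm X (s i \<ominus> l) * hnorm X v) \<longlonglongrightarrow> 0"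
    using tendsto_mult_right [OF assms(3)] by simp
  moreover have "cmod (hinner X (s i) v - hinner X l v) \<le> hnorm X (s i \<ominus> l) * hnorm X v" for i
    using Cauchy_Schwarz [of "s i \<ominus> l" v] assms by (simp add: hinner_simps image_subset_iff)
  ultimately have "(\<lambda>i. hinner X (s i) v - hinner X l v) \<longlonglongrightarrow> 0"
    by (metis (no_types, lifting) Lim_null_comparison always_eventually)
  then show ?thesis by (simp add: LIM_zero_iff)
qed

text \<open>Variational proof: the representing vector minimizes \<open>J x\<close>, the squared
  norm of \<open>x\<close> minus 2 Re (f x). A minimizing sequence is Cauchy by the parallelogram
  law, and the vanishing first variation at its limit is the representation formula.\<close>

lemma riesz_representation:
  assumes f_add: "\<And>x y. \<lbrakk>x \<in> carrier X; y \<in> carrier X\<rbrakk> \<Longrightarrow> f (x \<oplus> y) = f x + f y"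
    and f_smult: "\<And>c x. x \<in> carrier X \<Longrightarrow> f (c \<odot> x) = c * f x"
    and f_bound: "\<And>x. x \<in> carrier X \<Longrightarrow> cmod (f x) \<le> C * hnorm X x"
  shows "\<exists>y\<in>carrier X. \<forall>x\<in>carrier X. f x = hinner X x y"
proof -
  define J where "J x = (hnorm X x)\<^sup>2 - 2 * Re (f x)" for x
  have J_lower: "- C\<^sup>2 \<le> J x" if "x \<in> carrier X" for x
  proof -
    have "Re (f x) \<le> C * hnorm X x"
      using f_bound [OF that] complex_Re_le_cmod order_trans by blast
    moreover have "0 \<le> (hnorm X x - C)\<^sup>2" by simp
    ultimately show ?thesis
      by (simp add: J_def power2_diff algebra_simps)
  qed
  define m where "m = Inf (J ` carrier X)"
  have bdd: "bdd_below (J ` carrier X)"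
    using J_lower by (auto intro!: bdd_belowI)
  have m_le: "m \<le> J x" if "x \<in> carrier X" for x
    unfolding m_def using that bdd by (simp add: cInf_lower)
  have "\<exists>x\<in>carrier X. J x < m + 1 / real (Suc i)" for i
  proof -
    have "m < m + 1 / real (Suc i)" by simp
    then show ?thesis
      unfolding m_def using cInf_lessD [of "J ` carrier X"] by force
  qed
  then obtain s where s: "\<And>i. s i \<in> carrier X" and sJ: "\<And>i. J (s i) < m + 1 / real (Suc i)"
    by metis
  \<comment> \<open>Parallelogram law written in terms of \<open>J\<close>: the linear terms cancel
    because \<open>f\<close> is additive.\<close>
  have par: "(hnorm X (x \<ominus> y))\<^sup>2 = 2 * J x + 2 * J y - 4 * J ((1/2) \<odot> (x \<oplus> y))"
    if "x \<in> carrier X" "y \<in> carrier X" for x y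
    using that
    by (simp add: J_def f_add f_smult hinner_simps algebra_simps flip: Re_hinner_self)
  have dist: "(hnorm X (s i \<ominus> s j))\<^sup>2 \<le> 2 / real (Suc i) + 2 / real (Suc j)" for i j
    using par [OF s s, of i j] m_le [of "(1/2) \<odot> (s i \<oplus> s j)"] sJ [of i] sJ [of j] s
    by auto
  have "\<exists>l\<in>carrier X. (\<lambda>i. hnorm X (s i \<ominus> l)) \<longlonglongrightarrow> 0"
  proof (rule complete)
    show "range s \<subseteq> carrier X" using s by auto
    show "\<forall>e>0. \<exists>N. \<forall>i\<ge>N. \<forall>j\<ge>N. hnorm X (s i \<ominus> s j) < e"
    proof (intro allI impI)
      fix e :: real assume "e > 0"
      then have e4: "e\<^sup>2 / 4 > 0" by simp
      obtain N where N: "1 / real (Suc N) < e\<^sup>2 / 4"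
        using reals_Archimedean [OF e4] by (auto simp: inverse_eq_divide)
      show "\<exists>N. \<forall>i\<ge>N. \<forall>j\<ge>N. hnorm X (s i \<ominus> s j) < e"
      proof (intro exI allI impI)
        fix i j assume ij: "N \<le> i" "N \<le> j"
        have le: "1 / real (Suc k) \<le> 1 / real (Suc N)" if "N \<le> k" for k
          using that by (simp add: frac_le)
        have "(hnorm X (s i \<ominus> s j))\<^sup>2 < e\<^sup>2"
          using dist [of i j] N le [OF ij(1)] le [OF ij(2)] by auto
        then show "hnorm X (s i \<ominus> s j) < e"
          using \<open>e > 0\<close> by (simp add: power2_less_imp_less)
      qed
    qed
  qed
  then obtain l where l: "l \<in> carrier X" and lim: "(\<lambda>i. hnorm X (s i \<ominus> l)) \<longlonglongrightarrow> 0" by blast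
  \<comment> \<open>Minimality is used along the sequence and not at \<open>l\<close>: the increment
    of \<open>J\<close> in direction \<open>v\<close> depends on \<open>s i\<close> only through its
    inner product with \<open>v\<close>, and that converges.\<close>
  have var: "0 \<le> 2 * t * Re (hinner X l v - f v) + t\<^sup>2 * (hnorm X v)\<^sup>2" if v: "v \<in> carrier X" for t v
  proof -
    have "- (1 / real (Suc i)) \<le> 2 * t * Re (hinner X (s i) v - f v) + t\<^sup>2 * (hnorm X v)\<^sup>2" for i
    proof -
      have "J (s i \<oplus> of_real t \<odot> v) - J (s i)
          = 2 * t * Re (hinner X (s i) v - f v) + t\<^sup>2 * (hnorm X v)\<^sup>2"
        using v s hinner_commute [of v "s i"]
        by (simp add: J_def f_add f_smult hinner_simps algebra_simps power2_eq_square [of t]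
            flip: Re_hinner_self)
      then show ?thesis
        using m_le [of "s i \<oplus> of_real t \<odot> v"] sJ [of i] v s by auto
    qed
    moreover have "(\<lambda>i. 2 * t * Re (hinner X (s i) v - f v) + t\<^sup>2 * (hnorm X v)\<^sup>2)
        \<longlonglongrightarrow> 2 * t * Re (hinner X l v - f v) + t\<^sup>2 * (hnorm X v)\<^sup>2"
      using hinner_tendsto [OF _ l lim v] s by (intro tendsto_intros) auto
    moreover have "(\<lambda>i. - (1 / real (Suc i))) \<longlonglongrightarrow> 0"
      using tendsto_minus [OF LIMSEQ_inverse_real_of_nat] by (simp add: inverse_eq_divide)
    ultimately show ?thesis
      by (meson LIMSEQ_le)
  qed
  have Re0: "Re (hinner X l v - f v) = 0" if v: "v \<in> carrier X" for v
  proof (rule ccontr)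
    define a where "a = Re (hinner X l v - f v)"
    \<comment> \<open>The test value t = -a/b almost minimizes the quadratic in \<open>var\<close>;
      the summand 1 keeps \<open>b\<close> positive when \<open>v\<close> has norm zero.\<close>
    define b where "b = (hnorm X v)\<^sup>2 + 1"
    assume "Re (hinner X l v - f v) \<noteq> 0"
    then have a: "a\<^sup>2 > 0" by (simp add: a_def)
    have b: "b > 0" by (simp add: b_def add_nonneg_pos)
    have "0 \<le> 2 * (- a / b) * a + (- a / b)\<^sup>2 * (hnorm X v)\<^sup>2"
      using var [OF v, of "- a / b"] by (simp add: a_def)
    also have "\<dots> \<le> 2 * (- a / b) * a + (- a / b)\<^sup>2 * b"
      by (intro add_left_mono mult_left_mono) (auto simp: b_def)
    also have "\<dots> = - (a\<^sup>2 / b)"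
      using b by (simp add: field_simps power2_eq_square)
    finally show False
      using divide_pos_pos [OF a b] by linarith
  qed
  have "f v = hinner X v l" if v: "v \<in> carrier X" for v
  proof -
    \<comment> \<open>The real-part identity at \<i> v is the imaginary-part identity at
      \<open>v\<close>.\<close>
    have "Re (hinner X l (\<i> \<odot> v) - f (\<i> \<odot> v)) = 0"
      using v by (intro Re0) auto
    then have "Im (f v) = - Im (hinner X l v)"
      using v l by (simp add: f_smult hinner_simps)
    moreover have "Re (f v) = Re (hinner X l v)" using Re0 [OF v] by simp
    ultimately show ?thesis
      using hinner_commute [OF v l] by (simp add: complex_eq_iff)
  qed
  then show ?thesis using l by blast
qed

section \<open>Bounded operators and adjoints\<close>

lemma BO_I:
  assumes "T \<in> carrier X \<rightarrow>\<^sub>E carrier X"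
    and "\<And>x y. \<lbrakk>x \<in> carrier X; y \<in> carrier X\<rbrakk> \<Longrightarrow> T (x \<oplus> y) = T x \<oplus> T y"
    and "\<And>c x. x \<in> carrier X \<Longrightarrow> T (c \<odot> x) = c \<odot> T x"
    and "\<And>x. x \<in> carrier X \<Longrightarrow> hnorm X (T x) \<le> C * hnorm X x"
  shows "T \<in> carrier (BO X)"
  unfolding BO_def using assms(1-3) by (auto intro!: exI [of _ C] assms(4))

lemma BO_closed [simp, intro]: "T \<in> carrier (BO X) \<Longrightarrow> x \<in> carrier X \<Longrightarrow> T x \<in> carrier X"
  by (auto simp: BO_def)

lemma BO_additive:
  "\<lbrakk>T \<in> carrier (BO X); x \<in> carrier X; y \<in> carrier X\<rbrakk> \<Longrightarrow> T (x \<oplus> y) = T x \<oplus> T y"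
  by (auto simp: BO_def)

lemma BO_homogeneous:
  "\<lbrakk>T \<in> carrier (BO X); x \<in> carrier X\<rbrakk> \<Longrightarrow> T (c \<odot> x) = c \<odot> T x"
  by (auto simp: BO_def)

lemma BO_bounded:
  assumes "T \<in> carrier (BO X)"
  obtains C where "0 \<le> C" "\<And>x. x \<in> carrier X \<Longrightarrow> hnorm X (T x) \<le> C * hnorm X x"
proof -
  obtain C where C: "\<And>x. x \<in> carrier X \<Longrightarrow> hnorm X (T x) \<le> C * hnorm X x"
    using assms unfolding BO_def by auto blast
  show ?thesis
  proof
    show "0 \<le> \<bar>C\<bar>" by simp
    show "hnorm X (T x) \<le> \<bar>C\<bar> * hnorm X x" if "x \<in> carrier X" for x
      using C [OF that] mult_right_mono [of C "\<bar>C\<bar>" "hnorm X x"] that by force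
  qed
qed

lemma BO_ext:
  assumes "S \<in> carrier (BO X)" "T \<in> carrier (BO X)" "\<And>x. x \<in> carrier X \<Longrightarrow> S x = T x"
  shows "S = T"
  using assms by (auto simp: BO_def intro: PiE_ext)

lemma BO_ext_inner:
  assumes "S \<in> carrier (BO X)" "T \<in> carrier (BO X)"
    and "\<And>x y. \<lbrakk>x \<in> carrier X; y \<in> carrier X\<rbrakk> \<Longrightarrow> hinner X (S x) y = hinner X (T x) y"
  shows "S = T"
  using assms by (intro BO_ext hinner_ext) auto

lemma BO_add_apply [simp]: "x \<in> carrier X \<Longrightarrow> (S \<oplus>\<^bsub>BO X\<^esub> T) x = S x \<oplus> T x"
  and BO_smult_apply [simp]: "x \<in> carrier X \<Longrightarrow> (c \<odot>\<^bsub>BO X\<^esub> T) x = c \<odot> T x"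
  and BO_mult_apply [simp]: "x \<in> carrier X \<Longrightarrow> (S \<otimes>\<^bsub>BO X\<^esub> T) x = S (T x)"
  and BO_zero_apply [simp]: "x \<in> carrier X \<Longrightarrow> \<zero>\<^bsub>BO X\<^esub> x = \<zero>"
  and BO_one_apply [simp]: "x \<in> carrier X \<Longrightarrow> \<one>\<^bsub>BO X\<^esub> x = x"
  by (simp_all add: BO_def compose_def)

lemma BO_zero_closed [simp, intro]: "\<zero>\<^bsub>BO X\<^esub> \<in> carrier (BO X)"
  by (rule BO_I [where C = 0]) (auto simp: BO_def)

lemma BO_one_closed [simp, intro]: "\<one>\<^bsub>BO X\<^esub> \<in> carrier (BO X)"
  by (rule BO_I [where C = 1]) (auto simp: BO_def)

lemma BO_add_closed [simp, intro]:
  assumes "S \<in> carrier (BO X)" "T \<in> carrier (BO X)"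
  shows "S \<oplus>\<^bsub>BO X\<^esub> T \<in> carrier (BO X)"
proof -
  obtain C D where C: "\<And>x. x \<in> carrier X \<Longrightarrow> hnorm X (S x) \<le> C * hnorm X x"
    and D: "\<And>x. x \<in> carrier X \<Longrightarrow> hnorm X (T x) \<le> D * hnorm X x"
    using BO_bounded assms by metis
  have eq: "S \<oplus>\<^bsub>BO X\<^esub> T = (\<lambda>x\<in>carrier X. S x \<oplus> T x)"
    by (simp add: BO_def)
  show ?thesis unfolding eq
  proof (rule BO_I [where C = "C + D"])
    fix x assume x: "x \<in> carrier X"
    show "hnorm X ((\<lambda>x\<in>carrier X. S x \<oplus> T x) x) \<le> (C + D) * hnorm X x"
      using C [OF x] D [OF x] hnorm_triangle [of "S x" "T x"] assms x
      by (simp add: distrib_right)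
  qed (use assms in \<open>auto simp: BO_additive BO_homogeneous smult_r_distr M.a_ac\<close>)
qed

lemma BO_smult_closed [simp, intro]:
  assumes "T \<in> carrier (BO X)"
  shows "c \<odot>\<^bsub>BO X\<^esub> T \<in> carrier (BO X)"
proof -
  obtain D where D: "\<And>x. x \<in> carrier X \<Longrightarrow> hnorm X (T x) \<le> D * hnorm X x"
    using BO_bounded assms by metis
  have eq: "c \<odot>\<^bsub>BO X\<^esub> T = (\<lambda>x\<in>carrier X. c \<odot> T x)"
    by (simp add: BO_def)
  show ?thesis unfolding eq
  proof (rule BO_I [where C = "cmod c * D"])
    fix x assume x: "x \<in> carrier X"
    show "hnorm X ((\<lambda>x\<in>carrier X. c \<odot> T x) x) \<le> cmod c * D * hnorm X x"
      using mult_left_mono [OF D [OF x], of "cmod c"] assms x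
      by (simp add: hnorm_smult mult.assoc)
  next
    fix a x assume x: "x \<in> carrier X"
    show "(\<lambda>x\<in>carrier X. c \<odot> T x) (a \<odot> x) = a \<odot> (\<lambda>x\<in>carrier X. c \<odot> T x) x"
      using assms x smult_assoc1 [of c a "T x"] smult_assoc1 [of a c "T x"]
      by (simp add: BO_homogeneous mult.commute)
  qed (use assms in \<open>auto simp: BO_additive smult_r_distr\<close>)
qed

lemma BO_mult_closed [simp, intro]:
  assumes "S \<in> carrier (BO X)" "T \<in> carrier (BO X)"
  shows "S \<otimes>\<^bsub>BO X\<^esub> T \<in> carrier (BO X)"
proof -
  obtain C D where C: "0 \<le> C" "\<And>x. x \<in> carrier X \<Longrightarrow> hnorm X (S x) \<le> C * hnorm X x"
    and D: "\<And>x. x \<in> carrier X \<Longrightarrow> hnorm X (T x) \<le> D * hnorm X x"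
    using BO_bounded assms by metis
  have eq: "S \<otimes>\<^bsub>BO X\<^esub> T = (\<lambda>x\<in>carrier X. S (T x))"
    by (simp add: BO_def compose_def)
  show ?thesis unfolding eq
  proof (rule BO_I [where C = "C * D"])
    fix x assume x: "x \<in> carrier X"
    show "hnorm X ((\<lambda>x\<in>carrier X. S (T x)) x) \<le> C * D * hnorm X x"
      using mult_left_mono [OF D [OF x] C(1)] C(2) [of "T x"] assms x
      by (simp add: mult.assoc)
  qed (use assms in \<open>auto simp: BO_additive BO_homogeneous\<close>)
qed

lemma abelian_group_BO: "abelian_group (BO X)"
proof (rule abelian_groupI)
  fix S assume S: "S \<in> carrier (BO X)"
  have "(- 1) \<odot>\<^bsub>BO X\<^esub> S \<oplus>\<^bsub>BO X\<^esub> S = \<zero>\<^bsub>BO X\<^esub>"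
    using S by (intro BO_ext_inner) (auto simp: hinner_simps)
  then show "\<exists>T\<in>carrier (BO X). T \<oplus>\<^bsub>BO X\<^esub> S = \<zero>\<^bsub>BO X\<^esub>"
    using S by blast
qed (auto intro!: BO_ext simp: M.a_ac)

sublocale BO: abelian_group "BO X"
  by (rule abelian_group_BO)

text \<open>Negation on \<open>BO X\<close> is the abstract inverse of the additive group, so its
  pointwise form has to come from uniqueness of inverses.\<close>

lemma BO_uminus_apply [simp]:
  assumes "T \<in> carrier (BO X)" "x \<in> carrier X"
  shows "(\<ominus>\<^bsub>BO X\<^esub> T) x = \<ominus> T x"
proof -
  have "(\<ominus>\<^bsub>BO X\<^esub> T \<oplus>\<^bsub>BO X\<^esub> T) x = \<zero>"
    using assms by (simp add: BO.l_neg del: BO_add_apply)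
  then have "(\<ominus>\<^bsub>BO X\<^esub> T) x \<oplus> T x = \<zero>"
    using assms by simp
  then show ?thesis
    using assms by (metis BO.a_inv_closed BO_closed M.minus_equality)
qed

lemma BO_minus_apply [simp]:
  assumes "S \<in> carrier (BO X)" "T \<in> carrier (BO X)" "x \<in> carrier X"
  shows "(S \<ominus>\<^bsub>BO X\<^esub> T) x = S x \<ominus> T x"
  using assms by (simp add: BO.minus_eq M.minus_eq)

lemma hinner_BO_finsum:
  assumes f: "f \<in> I \<rightarrow> carrier (BO X)" and x: "x \<in> carrier X" and y: "y \<in> carrier X"
  shows "hinner X ((\<Oplus>\<^bsub>BO X\<^esub>i\<in>I. f i) x) y = (\<Sum>i\<in>I. hinner X (f i x) y)"
proof (cases "finite I")
  case True
  then show ?thesis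
    using f
  proof (induction I)
    case (insert i I)
    then have "(\<Oplus>\<^bsub>BO X\<^esub>j\<in>insert i I. f j) = f i \<oplus>\<^bsub>BO X\<^esub> (\<Oplus>\<^bsub>BO X\<^esub>j\<in>I. f j)"
      by (intro BO.finsum_insert) auto
    moreover have "(\<Oplus>\<^bsub>BO X\<^esub>j\<in>I. f j) \<in> carrier (BO X)"
      using insert by (intro BO.finsum_closed) auto
    ultimately show ?case
      using insert x y by (simp add: hinner_simps Pi_iff)
  qed (use x y in simp)
next
  \<comment> \<open>Both sums default to zero on an infinite index set.\<close>
  case False
  then show ?thesis using x y by (simp add: BO.finsum_infinite)
qed

section \<open>The operator norm, adjoints and norm-convergent series\<close>

lemma hnorm_le_opnorm_if_unit:
  assumes T: "T \<in> carrier (BO X)" and x: "x \<in> carrier X" "hnorm X x \<le> 1"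
  shows "hnorm X (T x) \<le> opnorm X T"
proof -
  obtain C where C: "0 \<le> C" "\<And>x. x \<in> carrier X \<Longrightarrow> hnorm X (T x) \<le> C * hnorm X x"
    using BO_bounded T by metis
  have "bdd_above {hnorm X (T x) |x. x \<in> carrier X \<and> hnorm X x \<le> 1}"
  proof (rule bdd_aboveI, clarify)
    fix y assume "y \<in> carrier X" "hnorm X y \<le> 1"
    then show "hnorm X (T y) \<le> C"
      using C(2) [of y] mult_left_le [of "hnorm X y" C] C(1) by linarith
  qed
  then show ?thesis
    unfolding opnorm_def using x by (intro cSup_upper) auto
qed

lemma hnorm_le_opnorm:
  assumes T: "T \<in> carrier (BO X)" and x: "x \<in> carrier X"
  shows "hnorm X (T x) \<le> opnorm X T * hnorm X x"
proof (cases "hnorm X x = 0")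
  \<comment> \<open>A vector of norm zero cannot be normalized; any bound of \<open>T\<close> shows
    that its image has norm zero too.\<close>
  case True
  obtain C where "\<And>x. x \<in> carrier X \<Longrightarrow> hnorm X (T x) \<le> C * hnorm X x"
    using BO_bounded T by metis
  from this [OF x] show ?thesis using True by simp
next
  case False
  then have pos: "hnorm X x > 0" using x by (simp add: order_less_le)
  define u where "u = of_real (1 / hnorm X x) \<odot> x"
  have u: "u \<in> carrier X" "hnorm X u = 1"
    using x pos by (auto simp: u_def hnorm_smult norm_divide)
  have "hnorm X (T u) \<le> opnorm X T"
    using u T by (intro hnorm_le_opnorm_if_unit) auto
  moreover have "hnorm X (T u) = hnorm X (T x) / hnorm X x"
    using T x pos by (simp add: u_def BO_homogeneous hnorm_smult norm_divide)
  ultimately show ?thesis using pos by (simp add: field_simps)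
qed

lemma opnorm_le:
  assumes c: "0 \<le> c" and bound: "\<And>x. x \<in> carrier X \<Longrightarrow> hnorm X (T x) \<le> c * hnorm X x"
  shows "opnorm X T \<le> c"
  unfolding opnorm_def
proof (rule cSup_least)
  show "{hnorm X (T x) |x. x \<in> carrier X \<and> hnorm X x \<le> 1} \<noteq> {}"
    using M.zero_closed hnorm_zero by fastforce
  fix r assume "r \<in> {hnorm X (T x) |x. x \<in> carrier X \<and> hnorm X x \<le> 1}"
  then obtain x where x: "x \<in> carrier X" "hnorm X x \<le> 1" and r: "r = hnorm X (T x)" by blast
  show "r \<le> c"
    using bound [OF x(1)] mult_left_le [OF x(2) c] r by linarith
qed

lemma opnorm_nonneg: "T \<in> carrier (BO X) \<Longrightarrow> 0 \<le> opnorm X T"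
  by (rule order_trans [OF hnorm_nonneg [of "T \<zero>"] hnorm_le_opnorm_if_unit [of T \<zero>]]) simp_all

lemma opnorm_smult_le:
  assumes T: "T \<in> carrier (BO X)"
  shows "opnorm X (c \<odot>\<^bsub>BO X\<^esub> T) \<le> cmod c * opnorm X T"
proof (rule opnorm_le)
  show "0 \<le> cmod c * opnorm X T" using T by (simp add: opnorm_nonneg)
  fix x assume x: "x \<in> carrier X"
  show "hnorm X ((c \<odot>\<^bsub>BO X\<^esub> T) x) \<le> cmod c * opnorm X T * hnorm X x"
    using mult_left_mono [OF hnorm_le_opnorm [OF T x], of "cmod c"] T x
    by (simp add: hnorm_smult mult.assoc)
qed

lemma cmod_hinner_BO_le:
  assumes T: "T \<in> carrier (BO X)" and x: "x \<in> carrier X" and y: "y \<in> carrier X"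
  shows "cmod (hinner X (T x) y) \<le> opnorm X T * hnorm X x * hnorm X y"
  using Cauchy_Schwarz [of "T x" y] mult_right_mono [OF hnorm_le_opnorm [OF T x], of "hnorm X y"]
    T x y by force

text \<open>For fixed \<open>y\<close> the functional x \<mapsto> <T x, y> is bounded, and Riesz
  supplies the value at \<open>y\<close>. The bound on the adjoint S comes from \<parallel>S
  y\<parallel>^2 = <T (S y), y> after cancelling one factor.\<close>

lemma adjoint_exists:
  assumes T: "T \<in> carrier (BO X)"
  shows "\<exists>S\<in>carrier (BO X). \<forall>x\<in>carrier X. \<forall>y\<in>carrier X. hinner X (T x) y = hinner X x (S y)"
proof -
  obtain C where C: "0 \<le> C" "\<And>x. x \<in> carrier X \<Longrightarrow> hnorm X (T x) \<le> C * hnorm X x"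
    using BO_bounded T by metis
  have "\<exists>z\<in>carrier X. \<forall>x\<in>carrier X. hinner X (T x) y = hinner X x z" if y: "y \<in> carrier X" for y
  proof (rule riesz_representation)
    fix x assume x: "x \<in> carrier X"
    show "cmod (hinner X (T x) y) \<le> (C * hnorm X y) * hnorm X x"
      using Cauchy_Schwarz [of "T x" y] mult_right_mono [OF C(2) [OF x], of "hnorm X y"] T x y
      by (simp add: mult_ac)
  qed (use T y in \<open>simp_all add: BO_additive BO_homogeneous hinner_simps\<close>)
  then obtain S0 where S0: "\<And>y. y \<in> carrier X \<Longrightarrow> S0 y \<in> carrier X"
    "\<And>x y. \<lbrakk>x \<in> carrier X; y \<in> carrier X\<rbrakk> \<Longrightarrow> hinner X (T x) y = hinner X x (S0 y)"
    by metis
  \<comment> \<open>Conjugation moves \<open>S0\<close> to the left slot, where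
    \<open>hinner_ext\<close> can test its linearity.\<close>
  have S0': "hinner X (S0 y) x = hinner X y (T x)" if "x \<in> carrier X" "y \<in> carrier X" for x y
    using S0 T that by (metis BO_closed hinner_commute)
  define S where "S = restrict S0 (carrier X)"
  have "S \<in> carrier (BO X)"
  proof (rule BO_I [where C = C])
    show "S \<in> carrier X \<rightarrow>\<^sub>E carrier X" using S0 by (auto simp: S_def)
    show "S (x \<oplus> y) = S x \<oplus> S y" if "x \<in> carrier X" "y \<in> carrier X" for x y
      using that S0(1) T by (intro hinner_ext) (auto simp: S_def S0' hinner_simps)
    show "S (c \<odot> x) = c \<odot> S x" if "x \<in> carrier X" for c x
      using that S0(1) T by (intro hinner_ext) (auto simp: S_def S0' hinner_simps)
    fix y assume y: "y \<in> carrier X"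
    have "(hnorm X (S0 y))\<^sup>2 = cmod (hinner X (S0 y) (S0 y))"
      using S0(1) [OF y] by (simp add: hinner_self norm_power)
    also have "\<dots> = cmod (hinner X (T (S0 y)) y)"
      using S0 y by simp
    also have "\<dots> \<le> hnorm X (T (S0 y)) * hnorm X y"
      using S0 y T by (intro Cauchy_Schwarz) auto
    also have "\<dots> \<le> C * hnorm X (S0 y) * hnorm X y"
      using S0 y C by (intro mult_right_mono) auto
    finally have "hnorm X (S0 y) * hnorm X (S0 y) \<le> (C * hnorm X y) * hnorm X (S0 y)"
      by (simp add: power2_eq_square mult_ac)
    then have "hnorm X (S0 y) \<le> C * hnorm X y"
      using S0(1) [OF y] C(1) y
      by (metis hnorm_nonneg mult_nonneg_nonneg mult_right_le_imp_le order_less_le)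
    then show "hnorm X (S y) \<le> C * hnorm X y" using y by (simp add: S_def)
  qed
  then show ?thesis using S0 by (intro bexI [of _ S]) (auto simp: S_def)
qed

lemma
  assumes T: "T \<in> carrier (BO X)"
  shows adj_closed [simp, intro]: "adj X T \<in> carrier (BO X)"
    and hinner_adj: "\<lbrakk>x \<in> carrier X; y \<in> carrier X\<rbrakk> \<Longrightarrow> hinner X (T x) y = hinner X x (adj X T y)"
    and adj_unique: "\<lbrakk>S \<in> carrier (BO X);
        \<And>x y. \<lbrakk>x \<in> carrier X; y \<in> carrier X\<rbrakk> \<Longrightarrow> hinner X (T x) y = hinner X x (S y)\<rbrakk> \<Longrightarrow> adj X T = S"
proof -
  let ?P = "\<lambda>S. S \<in> carrier (BO X) \<and>
     (\<forall>x\<in>carrier X. \<forall>y\<in>carrier X. hinner X (T x) y = hinner X x (S y))"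
  have uniq: "S = S'" if S: "?P S" and S': "?P S'" for S S'
  proof (rule BO_ext_inner)
    fix x y assume xy: "x \<in> carrier X" "y \<in> carrier X"
    then have "hinner X y (S x) = hinner X y (S' x)" using S S' by metis
    then show "hinner X (S x) y = hinner X (S' x) y"
      using xy S S' by (metis BO_closed hinner_commute)
  qed (use S S' in auto)
  have ex1: "\<exists>!S. ?P S"
    using adjoint_exists [OF T] uniq by blast
  have P: "?P (adj X T)"
    unfolding adj_def by (rule theI' [OF ex1])
  then show "adj X T \<in> carrier (BO X)"
    and "\<lbrakk>x \<in> carrier X; y \<in> carrier X\<rbrakk> \<Longrightarrow> hinner X (T x) y = hinner X x (adj X T y)"
    by auto
  show "adj X T = S" if "S \<in> carrier (BO X)"
      "\<And>x y. \<lbrakk>x \<in> carrier X; y \<in> carrier X\<rbrakk> \<Longrightarrow> hinner X (T x) y = hinner X x (S y)"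
    using uniq P that by blast
qed

lemma hinner_adj_left:
  assumes "T \<in> carrier (BO X)" "x \<in> carrier X" "y \<in> carrier X"
  shows "hinner X (adj X T x) y = hinner X x (T y)"
  using assms by (metis BO_closed adj_closed hinner_adj hinner_commute)

lemma adj_smult:
  assumes "T \<in> carrier (BO X)"
  shows "adj X (c \<odot>\<^bsub>BO X\<^esub> T) = cnj c \<odot>\<^bsub>BO X\<^esub> adj X T"
  using assms by (intro adj_unique) (auto simp: hinner_simps hinner_adj)

text \<open>The forms of \<open>T\<close> and its adjoint at \<open>x\<close> are complex
  conjugates, so the form of the real part is Re <T x, x>. This turns the operator inequality into
  the scalar positivity used by the coefficient bound.\<close>

lemma op_le_one_re_op:
  assumes T: "T \<in> carrier (BO X)" and le: "op_le X (re_op X T) \<one>\<^bsub>BO X\<^esub>" and x: "x \<in> carrier X"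
  shows "Re (hinner X (T x) x) \<le> (hnorm X x)\<^sup>2"
proof -
  have "hinner X (adj X T x) x = cnj (hinner X (T x) x)"
    using T x hinner_adj_left [OF T x x] hinner_commute [of x "T x"] by simp
  moreover have "0 \<le> Re (hinner X ((\<one>\<^bsub>BO X\<^esub> \<ominus>\<^bsub>BO X\<^esub> re_op X T) x) x)"
    using le x by (simp add: op_le_def)
  ultimately show ?thesis
    using T x by (simp add: re_op_def hinner_simps hinner_self)
qed

text \<open>Every later use of convergence goes through these matrix coefficients: they identify the
  limit uniquely and turn the operator series into scalar power series.\<close>

lemma op_sums_hinner:
  assumes f: "\<And>k. f k \<in> carrier (BO X)" and S: "op_sums X f S"
    and x: "x \<in> carrier X" and y: "y \<in> carrier X"
  shows "(\<lambda>k. hinner X (f k x) y) sums hinner X (S x) y"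
proof -
  define D where "D N = (\<Oplus>\<^bsub>BO X\<^esub>k\<in>{..<N}. f k) \<ominus>\<^bsub>BO X\<^esub> S" for N :: nat
  have S': "S \<in> carrier (BO X)" and lim: "(\<lambda>N. opnorm X (D N)) \<longlonglongrightarrow> 0"
    using S by (auto simp: op_sums_def D_def)
  have fin: "(\<Oplus>\<^bsub>BO X\<^esub>k\<in>{..<N}. f k) \<in> carrier (BO X)" for N :: nat
    using f by (intro BO.finsum_closed) auto
  have D: "D N \<in> carrier (BO X)" for N
    using S' fin by (auto simp: D_def)
  have eq: "(\<Sum>k<N. hinner X (f k x) y) - hinner X (S x) y = hinner X (D N x) y" for N
    using f S' fin x y
    by (simp add: D_def hinner_simps hinner_BO_finsum)
  have "(\<lambda>N. opnorm X (D N) * hnorm X x * hnorm X y) \<longlonglongrightarrow> 0"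
    using tendsto_mult_right [OF tendsto_mult_right [OF lim, of "hnorm X x"], of "hnorm X y"] by simp
  then have "(\<lambda>N. (\<Sum>k<N. hinner X (f k x) y) - hinner X (S x) y) \<longlonglongrightarrow> 0"
    by (rule Lim_null_comparison [rotated])
      (use cmod_hinner_BO_le [OF D x y] in \<open>simp add: eq\<close>)
  then show ?thesis
    by (simp add: sums_def LIM_zero_iff)
qed

lemma op_sums_unique:
  assumes f: "\<And>k. f k \<in> carrier (BO X)" and S: "op_sums X f S" and T: "op_sums X f T"
  shows "S = T"
proof (rule BO_ext_inner)
  show "hinner X (S x) y = hinner X (T x) y" if "x \<in> carrier X" "y \<in> carrier X" for x y
    using op_sums_hinner [OF f S that] op_sums_hinner [OF f T that] by (rule sums_unique2)
qed (use S T in \<open>auto simp: op_sums_def\<close>)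

text \<open>Gives \<open>nc_value\<close> its meaning, as that is exactly this description for the
  homogeneous parts.\<close>

lemma the_op_sums:
  assumes f: "\<And>k. f k \<in> carrier (BO X)" and S: "\<exists>S. op_sums X f S"
  shows "op_sums X f (THE S. op_sums X f S)"
proof -
  obtain S where S: "op_sums X f S" using assms by blast
  then show ?thesis
    by (rule theI [of "op_sums X f"]) (rule op_sums_unique [OF f _ S])
qed

end

section \<open>Operators on tensor products\<close>

text \<open>The densely defined map is given as a relation because its intended values are computed
  from representations of a vector. Being single-valued is then no separate hypothesis:
  \<open>R_bound\<close> applied to differences forces it. The closure \<open>L\<close> under limits
  of pairs is again linear and bounded, and by completeness it is total, hence the graph of an
  operator.\<close>

lemma (in hilbert_space) bounded_linear_relation_extends:
  assumes R: "R \<subseteq> carrier X \<times> carrier X"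
    and R_add: "\<And>a b c d. \<lbrakk>(a, b) \<in> R; (c, d) \<in> R\<rbrakk> \<Longrightarrow> (a \<oplus> c, b \<oplus> d) \<in> R"
    and R_smult: "\<And>a b c. (a, b) \<in> R \<Longrightarrow> (c \<odot> a, c \<odot> b) \<in> R"
    and R_bound: "\<And>a b. (a, b) \<in> R \<Longrightarrow> hnorm X b \<le> C * hnorm X a"
    and C: "0 \<le> C"
    and dense: "\<And>z e. \<lbrakk>z \<in> carrier X; 0 < e\<rbrakk> \<Longrightarrow> \<exists>(a, b) \<in> R. hnorm X (z \<ominus> a) < e"
  shows "\<exists>B\<in>carrier (BO X). (\<forall>(a, b)\<in>R. B a = b) \<and>
    (\<forall>x\<in>carrier X. hnorm X (B x) \<le> C * hnorm X x)"
proof -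
  define L where "L z w \<longleftrightarrow> z \<in> carrier X \<and> w \<in> carrier X \<and>
    (\<exists>a b. (\<forall>n::nat. (a n, b n) \<in> R) \<and>
       (\<lambda>n. hnorm X (a n \<ominus> z)) \<longlonglongrightarrow> 0 \<and> (\<lambda>n. hnorm X (b n \<ominus> w)) \<longlonglongrightarrow> 0)" for z w
  have add_lim: "(\<lambda>n. hnorm X ((a n \<oplus> c n) \<ominus> (z \<oplus> z'))) \<longlonglongrightarrow> 0"
    if "(\<lambda>n. hnorm X (a n \<ominus> z)) \<longlonglongrightarrow> 0" "(\<lambda>n. hnorm X (c n \<ominus> z')) \<longlonglongrightarrow> 0"
      and in_carrier: "\<And>n::nat. a n \<in> carrier X" "\<And>n. c n \<in> carrier X" "z \<in> carrier X" "z' \<in> carrier X"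
    for a c z z'
  proof (rule Lim_null_comparison)
    show "(\<lambda>n. hnorm X (a n \<ominus> z) + hnorm X (c n \<ominus> z')) \<longlonglongrightarrow> 0"
      using tendsto_add [OF that(1,2)] by simp
    have "(a n \<oplus> c n) \<ominus> (z \<oplus> z') = (a n \<ominus> z) \<oplus> (c n \<ominus> z')" for n
      using in_carrier by (intro hinner_ext) (auto simp: hinner_simps)
    then show "\<forall>\<^sub>F n in sequentially.
        norm (hnorm X ((a n \<oplus> c n) \<ominus> (z \<oplus> z'))) \<le> hnorm X (a n \<ominus> z) + hnorm X (c n \<ominus> z')"
      using in_carrier by (intro always_eventually) (auto simp: hnorm_triangle)
  qed
  have L_add: "L (z \<oplus> z') (w \<oplus> w')" if L: "L z w" "L z' w'" for z w z' w'
  proof -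
    obtain a b where ab: "\<And>n. (a n, b n) \<in> R"
      "(\<lambda>n. hnorm X (a n \<ominus> z)) \<longlonglongrightarrow> 0" "(\<lambda>n. hnorm X (b n \<ominus> w)) \<longlonglongrightarrow> 0"
      using L(1) unfolding L_def by blast
    obtain c d where cd: "\<And>n. (c n, d n) \<in> R"
      "(\<lambda>n. hnorm X (c n \<ominus> z')) \<longlonglongrightarrow> 0" "(\<lambda>n. hnorm X (d n \<ominus> w')) \<longlonglongrightarrow> 0"
      using L(2) unfolding L_def by blast
    have "a n \<in> carrier X" "b n \<in> carrier X" "c n \<in> carrier X" "d n \<in> carrier X" for n
      using ab(1) [of n] cd(1) [of n] R by auto
    then show ?thesis
      using L ab cd add_lim R_add unfolding L_def
      by (intro conjI exI [of _ "\<lambda>n. a n \<oplus> c n"] exI [of _ "\<lambda>n. b n \<oplus> d n"]) auto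
  qed
  have smult_lim: "(\<lambda>n. hnorm X (k \<odot> a n \<ominus> k \<odot> z)) \<longlonglongrightarrow> 0"
    if lim: "(\<lambda>n. hnorm X (a n \<ominus> z)) \<longlonglongrightarrow> 0"
      and in_carrier: "\<And>n::nat. a n \<in> carrier X" "z \<in> carrier X" for a z k
  proof -
    have "k \<odot> a n \<ominus> k \<odot> z = k \<odot> (a n \<ominus> z)" for n
      using in_carrier by (intro hinner_ext) (auto simp: hinner_simps algebra_simps)
    then have "hnorm X (k \<odot> a n \<ominus> k \<odot> z) = cmod k * hnorm X (a n \<ominus> z)" for n
      using in_carrier by (simp add: hnorm_smult)
    then show ?thesis
      using tendsto_mult_left [OF lim, of "cmod k"] by simp
  qed
  have L_smult: "L (k \<odot> z) (k \<odot> w)" if L: "L z w" for z w k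
  proof -
    obtain a b where ab: "\<And>n. (a n, b n) \<in> R"
      "(\<lambda>n. hnorm X (a n \<ominus> z)) \<longlonglongrightarrow> 0" "(\<lambda>n. hnorm X (b n \<ominus> w)) \<longlonglongrightarrow> 0"
      using L unfolding L_def by blast
    have "a n \<in> carrier X" "b n \<in> carrier X" for n
      using ab(1) [of n] R by auto
    then show ?thesis
      using L ab smult_lim R_smult unfolding L_def
      by (intro conjI exI [of _ "\<lambda>n. k \<odot> a n"] exI [of _ "\<lambda>n. k \<odot> b n"]) auto
  qed
  have L_bound: "hnorm X w \<le> C * hnorm X z" if L: "L z w" for z w
  proof -
    obtain a b where ab: "\<And>n. (a n, b n) \<in> R"
      "(\<lambda>n. hnorm X (a n \<ominus> z)) \<longlonglongrightarrow> 0" "(\<lambda>n. hnorm X (b n \<ominus> w)) \<longlonglongrightarrow> 0"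
      using L unfolding L_def by blast
    have "range a \<subseteq> carrier X" "range b \<subseteq> carrier X"
      using ab(1) R by auto
    then have "(\<lambda>n. hnorm X (b n)) \<longlonglongrightarrow> hnorm X w" "(\<lambda>n. C * hnorm X (a n)) \<longlonglongrightarrow> C * hnorm X z"
      using L ab by (auto simp: L_def intro!: tendsto_intros hnorm_tendsto)
    then show ?thesis
      by (rule LIMSEQ_le) (use R_bound ab(1) in blast)
  qed
  have L_unique: "w = w'" if L: "L z w" "L z w'" for z w w'
  proof -
    have w: "z \<in> carrier X" "w \<in> carrier X" "w' \<in> carrier X"
      using L by (auto simp: L_def)
    \<comment> \<open>By linearity \<open>L\<close> relates the zero vector to w - w', and the bound
      then makes w - w' vanish.\<close>
    have "hnorm X (w \<oplus> (- 1) \<odot> w') \<le> C * hnorm X (z \<oplus> (- 1) \<odot> z)"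
      by (intro L_bound L_add L_smult L)
    also have "z \<oplus> (- 1) \<odot> z = \<zero>"
      using w by (intro hinner_ext) (auto simp: hinner_simps)
    finally have "hnorm X (w \<oplus> (- 1) \<odot> w') \<le> 0"
      by simp
    then have 0: "w \<oplus> (- 1) \<odot> w' = \<zero>"
      using w by (subst (asm) hnorm_le_0_iff) auto
    show ?thesis
    proof (rule hinner_ext)
      fix v assume v: "v \<in> carrier X"
      have "hinner X (w \<oplus> (- 1) \<odot> w') v = 0" using v 0 by simp
      then show "hinner X w v = hinner X w' v" using w v by (simp add: hinner_simps)
    qed (use w in auto)
  qed
  have L_total: "\<exists>w. L z w" if z: "z \<in> carrier X" for z
  proof -
    have "\<exists>p. p \<in> R \<and> hnorm X (z \<ominus> fst p) < inverse (real (Suc n))" for n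
      using dense [OF z, of "inverse (real (Suc n))"] by fastforce
    then obtain p where p: "\<And>n. p n \<in> R" "\<And>n. hnorm X (z \<ominus> fst (p n)) < inverse (real (Suc n))"
      by metis
    define a b where "a n = fst (p n)" and "b n = snd (p n)" for n
    have ab: "(a n, b n) \<in> R" for n using p(1) by (simp add: a_def b_def)
    then have in_carrier: "a n \<in> carrier X" "b n \<in> carrier X" for n using R by blast+
    have a_le: "norm (hnorm X (a n \<ominus> z)) \<le> inverse (real (Suc n))" for n
      using p(2) [of n] z in_carrier(1) [of n] hnorm_minus_commute [of "a n" z]
      by (simp add: a_def del: of_nat_Suc)
    have a_lim: "(\<lambda>n. hnorm X (a n \<ominus> z)) \<longlonglongrightarrow> 0"
      by (rule Lim_null_comparison [OF always_eventually LIMSEQ_inverse_real_of_nat]) (use a_le in blast)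
    \<comment> \<open>The bound on differences carries the Cauchy property from the first components
      to the second ones.\<close>
    have b_diff: "hnorm X (b i \<ominus> b j) \<le> C * (hnorm X (a i \<ominus> z) + hnorm X (a j \<ominus> z))" for i j
    proof -
      have eq: "x \<ominus> y = x \<oplus> (- 1) \<odot> y" if "x \<in> carrier X" "y \<in> carrier X" for x y
        using that by (intro hinner_ext) (auto simp: hinner_simps)
      have "hnorm X (b i \<oplus> (- 1) \<odot> b j) \<le> C * hnorm X (a i \<oplus> (- 1) \<odot> a j)"
        by (intro R_bound R_add R_smult ab)
      then have "hnorm X (b i \<ominus> b j) \<le> C * hnorm X (a i \<ominus> a j)"
        using in_carrier by (simp add: eq)
      also have "\<dots> \<le> C * (hnorm X (a i \<ominus> z) + hnorm X (a j \<ominus> z))"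
        using hnorm_triangle_minus [of "a i" z "a j"] hnorm_minus_commute [of z "a j"] in_carrier z C
        by (intro mult_left_mono) auto
      finally show ?thesis .
    qed
    have "\<exists>w\<in>carrier X. (\<lambda>n. hnorm X (b n \<ominus> w)) \<longlonglongrightarrow> 0"
    proof (rule complete)
      show "range b \<subseteq> carrier X" using in_carrier by auto
      show "\<forall>e>0. \<exists>N. \<forall>i\<ge>N. \<forall>j\<ge>N. hnorm X (b i \<ominus> b j) < e"
      proof (intro allI impI)
        fix e :: real assume e: "0 < e"
        \<comment> \<open>Dividing by C + 1 instead of \<open>C\<close> allows C = 0.\<close>
        then have "0 < e / (C + 1) / 2" using C by simp
        then obtain N where N: "\<And>n. n \<ge> N \<Longrightarrow> norm (hnorm X (a n \<ominus> z) - 0) < e / (C + 1) / 2"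
          using LIMSEQ_D [OF a_lim] by blast
        show "\<exists>N. \<forall>i\<ge>N. \<forall>j\<ge>N. hnorm X (b i \<ominus> b j) < e"
        proof (intro exI allI impI)
          fix i j assume "N \<le> i" "N \<le> j"
          then have "hnorm X (a i \<ominus> z) < e / (C + 1) / 2" "hnorm X (a j \<ominus> z) < e / (C + 1) / 2"
            using N [of i] N [of j] by auto
          then have "hnorm X (a i \<ominus> z) + hnorm X (a j \<ominus> z) < e / (C + 1)"
            by linarith
          then have "(C + 1) * (hnorm X (a i \<ominus> z) + hnorm X (a j \<ominus> z)) < e"
            using C by (simp add: field_simps)
          moreover have "0 \<le> hnorm X (a i \<ominus> z) + hnorm X (a j \<ominus> z)"
            using in_carrier z by simp
          ultimately show "hnorm X (b i \<ominus> b j) < e"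
            using b_diff [of i j] by (simp add: distrib_right)
        qed
      qed
    qed
    then show ?thesis using ab a_lim z unfolding L_def by blast
  qed
  have L_R: "L a b" if "(a, b) \<in> R" for a b
  proof -
    have "hnorm X (x \<ominus> x) = 0" if "x \<in> carrier X" for x
      using that by (simp add: M.minus_eq M.r_neg)
    then show ?thesis
      using that R unfolding L_def
      by (intro conjI exI [of _ "\<lambda>_. a"] exI [of _ "\<lambda>_. b"]) auto
  qed
  define B where "B = (\<lambda>z\<in>carrier X. THE w. L z w)"
  have B: "L z (B z)" if "z \<in> carrier X" for z
    using that L_total [OF that] L_unique theI' [of "L z"] by (auto simp: B_def)
  have B_eq: "B z = w" if "L z w" for z w
    using B L_unique that by (metis L_def)
  have "B \<in> carrier (BO X)"
  proof (rule BO_I [where C = C])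
    show "B \<in> carrier X \<rightarrow>\<^sub>E carrier X"
      using B by (auto simp: L_def B_def)
    show "B (x \<oplus> y) = B x \<oplus> B y" if "x \<in> carrier X" "y \<in> carrier X" for x y
      using that by (intro B_eq L_add B)
    show "B (c \<odot> x) = c \<odot> B x" if "x \<in> carrier X" for c x
      using that by (intro B_eq L_smult B)
    show "hnorm X (B x) \<le> C * hnorm X x" if "x \<in> carrier X" for x
      using that by (intro L_bound B)
  qed
  then show ?thesis
    using B B_eq L_R L_bound by (intro bexI [of _ B]) auto
qed

text \<open>Iterating the square inequality along m = 2^j bounds (a 1 / a 0)^(2^j) by (K / a 0)
  c^(2^j). In the limit of 2^j-th roots the constant \<open>K\<close> disappears, so a crude growth
  bound gives an inequality without any loss.\<close>

lemma le_mult_if_square_le: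
  fixes a :: "nat \<Rightarrow> real"
  assumes nonneg: "\<And>m. 0 \<le> a m" and square: "\<And>m. (a m)\<^sup>2 \<le> a (2 * m) * a 0"
    and growth: "\<And>m. a m \<le> K * c ^ m" and c: "0 \<le> c"
  shows "a 1 \<le> c * a 0"
proof (cases "a 0 = 0")
  case True
  then show ?thesis using square [of 1] by simp
next
  case False
  then have a0: "a 0 > 0" using nonneg [of 0] by simp
  \<comment> \<open>The iterated inequality with denominators cleared.\<close>
  have iter: "a 1 ^ 2 ^ j * a 0 \<le> a (2 ^ j) * a 0 ^ 2 ^ j" for j
  proof (induction j)
    case (Suc j)
    have "(a 1 ^ 2 ^ Suc j * a 0) * a 0 = (a 1 ^ 2 ^ j * a 0)\<^sup>2"
      by (simp add: power2_eq_square power_mult_distrib mult_2 power_add algebra_simps)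
    also have "\<dots> \<le> (a (2 ^ j) * a 0 ^ 2 ^ j)\<^sup>2"
      by (intro power_mono Suc mult_nonneg_nonneg zero_le_power nonneg)
    also have "\<dots> = (a (2 ^ j))\<^sup>2 * a 0 ^ 2 ^ Suc j"
      by (simp add: power2_eq_square mult_2 power_add)
    also have "\<dots> \<le> (a (2 * 2 ^ j) * a 0) * a 0 ^ 2 ^ Suc j"
      by (intro mult_right_mono square zero_le_power nonneg)
    finally have "(a 1 ^ 2 ^ Suc j * a 0) * a 0 \<le> (a (2 ^ Suc j) * a 0 ^ 2 ^ Suc j) * a 0"
      by (simp add: mult_ac)
    then show ?case using a0 by (simp only: mult_le_cancel_right_pos)
  qed simp
  show ?thesis
  proof (rule ccontr)
    define r where "r = a 1 / a 0"
    \<comment> \<open>Roots are avoided by contradiction: if r > c, powers of r/c' are unbounded.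
      The midpoint replaces \<open>c\<close> because \<open>c\<close> may be zero.\<close>
    define c' where "c' = (r + c) / 2"
    assume "\<not> a 1 \<le> c * a 0"
    then have r: "c < r" using a0 by (simp add: r_def field_simps)
    then have c': "0 < c'" "c \<le> c'" "c' < r" using c by (auto simp: c'_def)
    have K: "0 \<le> K" using growth [of 0] nonneg [of 0] by simp
    have bound: "(r / c') ^ 2 ^ j \<le> K / a 0" for j
    proof -
      have "r ^ 2 ^ j \<le> a (2 ^ j) / a 0"
        using iter [of j] a0 by (simp add: r_def power_divide field_simps)
      also have "\<dots> \<le> K * c ^ 2 ^ j / a 0"
        using growth a0 by (simp add: divide_right_mono)
      also have "\<dots> \<le> K * c' ^ 2 ^ j / a 0"
        using a0 c c' K by (intro divide_right_mono mult_left_mono power_mono) auto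
      finally show ?thesis using c' by (simp add: power_divide field_simps)
    qed
    have q: "1 < r / c'" using c' by simp
    obtain m where "K / a 0 < (r / c') ^ m"
      using real_arch_pow [OF q] by blast
    also have "\<dots> \<le> (r / c') ^ 2 ^ m"
      using q by (intro power_increasing) (auto simp: less_imp_le)
    finally show False using bound [of m] by simp
  qed
qed

section \<open>Finite sums of elementary tensors\<close>

context hilbert_tensor
begin

text \<open>Lists instead of finite sets: applying maps to the factors may identify pairs, and
  joining two sums may repeat them; lists keep the multiplicities.\<close>

definition tensor_sum :: "('a \<times> 'b) list \<Rightarrow> 'c" where
  "tensor_sum ps = foldr (\<lambda>p z. t (fst p) (snd p) \<oplus>\<^bsub>Z\<^esub> z) ps \<zero>\<^bsub>Z\<^esub>"

lemma tensor_sum_simps [simp]: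
  "tensor_sum [] = \<zero>\<^bsub>Z\<^esub>"
  "tensor_sum (p # ps) = t (fst p) (snd p) \<oplus>\<^bsub>Z\<^esub> tensor_sum ps"
  by (simp_all add: tensor_sum_def)

lemma tensor_sum_closed [simp, intro]:
  "set ps \<subseteq> carrier X \<times> carrier H \<Longrightarrow> tensor_sum ps \<in> carrier Z"
  by (induction ps) (auto simp: tensor_closed)

lemma tensor_sum_append:
  "\<lbrakk>set ps \<subseteq> carrier X \<times> carrier H; set qs \<subseteq> carrier X \<times> carrier H\<rbrakk>
    \<Longrightarrow> tensor_sum (ps @ qs) = tensor_sum ps \<oplus>\<^bsub>Z\<^esub> tensor_sum qs"
  by (induction ps) (auto simp: tensor_closed Z.M.a_assoc)

lemma tensor_sum_smult:
  "set ps \<subseteq> carrier X \<times> carrier H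
    \<Longrightarrow> tensor_sum (map (map_prod (\<lambda>x. c \<odot>\<^bsub>X\<^esub> x) id) ps) = c \<odot>\<^bsub>Z\<^esub> tensor_sum ps"
  by (induction ps) (auto simp: tensor_closed tensor_smult_left Z.smult_r_distr)

lemma tensor_sum_eq_finsum:
  "\<lbrakk>distinct ps; set ps \<subseteq> carrier X \<times> carrier H\<rbrakk>
    \<Longrightarrow> tensor_sum ps = (\<Oplus>\<^bsub>Z\<^esub>p\<in>set ps. t (fst p) (snd p))"
proof (induction ps)
  case (Cons p ps)
  then show ?case
    by (auto simp: tensor_closed intro!: Z.M.finsum_insert [symmetric])
qed simp

lemma tensor_sum_dense:
  assumes "z \<in> carrier Z" "0 < e"
  shows "\<exists>ps. set ps \<subseteq> carrier X \<times> carrier H \<and> hnorm Z (z \<ominus>\<^bsub>Z\<^esub> tensor_sum ps) < e"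
proof -
  obtain P where P: "finite P" "P \<subseteq> carrier X \<times> carrier H"
    "hnorm Z (z \<ominus>\<^bsub>Z\<^esub> (\<Oplus>\<^bsub>Z\<^esub>p\<in>P. t (fst p) (snd p))) < e"
    using tensor_dense [OF assms] by blast
  obtain ps where "set ps = P" "distinct ps"
    using finite_distinct_list [OF P(1)] by blast
  then show ?thesis
    using P tensor_sum_eq_finsum [of ps] by auto
qed

lemma hinner_tensor_sum:
  assumes "set ps \<subseteq> carrier X \<times> carrier H" "set qs \<subseteq> carrier X \<times> carrier H"
  shows "hinner Z (tensor_sum ps) (tensor_sum qs)
    = (\<Sum>p\<leftarrow>ps. \<Sum>q\<leftarrow>qs. hinner X (fst p) (fst q) * hinner H (snd p) (snd q))"
  using assms(1)
proof (induction ps)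
  case (Cons p ps)
  have "hinner Z (t (fst p) (snd p)) (tensor_sum qs)
      = (\<Sum>q\<leftarrow>qs. hinner X (fst p) (fst q) * hinner H (snd p) (snd q))"
    using assms(2) Cons.prems
    by (induction qs) (auto simp: tensor_closed hinner_tensor Z.hinner_add_right)
  then show ?case
    using Cons assms(2) by (auto simp: tensor_closed Z.hinner_add_left)
qed (use assms(2) in simp)

text \<open>Moves S \<otimes> T across the inner product before it exists as an operator, by
  comparing double sums term by term. \<open>S\<close> and \<open>T\<close> are plain functions, so
  that the lemma also covers iterates that need not be extensional.\<close>

lemma hinner_tensor_sum_map:
  assumes ps: "set ps \<subseteq> carrier X \<times> carrier H" and qs: "set qs \<subseteq> carrier X \<times> carrier H"
    and S: "S \<in> carrier X \<rightarrow> carrier X" "S' \<in> carrier X \<rightarrow> carrier X"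
      "\<And>x y. \<lbrakk>x \<in> carrier X; y \<in> carrier X\<rbrakk> \<Longrightarrow> hinner X (S x) y = hinner X x (S' y)"
    and T: "T \<in> carrier H \<rightarrow> carrier H" "T' \<in> carrier H \<rightarrow> carrier H"
      "\<And>x y. \<lbrakk>x \<in> carrier H; y \<in> carrier H\<rbrakk> \<Longrightarrow> hinner H (T x) y = hinner H x (T' y)"
  shows "hinner Z (tensor_sum (map (map_prod S T) ps)) (tensor_sum qs)
    = hinner Z (tensor_sum ps) (tensor_sum (map (map_prod S' T') qs))"
proof -
  have "set (map (map_prod S T) ps) \<subseteq> carrier X \<times> carrier H"
    "set (map (map_prod S' T') qs) \<subseteq> carrier X \<times> carrier H"
    using ps qs S T by auto
  moreover have "hinner X (S (fst p)) (fst q) * hinner H (T (snd p)) (snd q)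
      = hinner X (fst p) (S' (fst q)) * hinner H (snd p) (T' (snd q))"
    if "p \<in> set ps" "q \<in> set qs" for p q
  proof -
    have "fst p \<in> carrier X" "snd p \<in> carrier H" "fst q \<in> carrier X" "snd q \<in> carrier H"
      using ps qs that by auto
    then show ?thesis by (simp add: S(3) T(3))
  qed
  ultimately show ?thesis
    using ps qs by (simp add: hinner_tensor_sum o_def cong: map_cong)
qed

lemma hnorm_tensor:
  assumes "x \<in> carrier X" "h \<in> carrier H"
  shows "hnorm Z (t x h) = hnorm X x * hnorm H h"
proof -
  have "hinner Z (t x h) (t x h) = of_real ((hnorm X x)\<^sup>2 * (hnorm H h)\<^sup>2)"
    using assms by (simp add: hinner_tensor X.hinner_self H.hinner_self)
  then have "(hnorm Z (t x h))\<^sup>2 = (hnorm X x * hnorm H h)\<^sup>2"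
    using assms by (simp add: tensor_closed power_mult_distrib flip: Z.Re_hinner_self)
  then show ?thesis
    using assms by (simp add: tensor_closed power2_eq_iff_nonneg)
qed

text \<open>The right-hand side depends on the representation \<open>ps\<close> and not only on the
  vector; it serves merely as the constant \<open>K\<close> of
  \<open>le_mult_if_square_le\<close>.\<close>

lemma hnorm_tensor_sum_le:
  "set ps \<subseteq> carrier X \<times> carrier H
    \<Longrightarrow> hnorm Z (tensor_sum ps) \<le> (\<Sum>p\<leftarrow>ps. hnorm X (fst p) * hnorm H (snd p))"
proof (induction ps)
  case (Cons p ps)
  then have p: "fst p \<in> carrier X" "snd p \<in> carrier H" and ps: "set ps \<subseteq> carrier X \<times> carrier H"
    by auto
  show ?case
    using Z.hnorm_triangle [OF tensor_closed [OF p] tensor_sum_closed [OF ps]] Cons.IH [OF ps]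
    by (simp add: hnorm_tensor [OF p])
qed simp

end

text \<open>Iterates of the self-adjoint map \<open>D\<close> are taken by \<open>funpow\<close> on
  vectors, in the form in which they act on the entries of a tensor sum.\<close>

lemma (in hilbert_space) funpow_adj:
  assumes T: "T \<in> carrier (BO X)"
  defines "D \<equiv> \<lambda>x. adj X T (T x)"
  shows "D ^^ m \<in> carrier X \<rightarrow> carrier X"
    and "\<lbrakk>x \<in> carrier X; y \<in> carrier X\<rbrakk> \<Longrightarrow> hinner X ((D ^^ m) x) y = hinner X x ((D ^^ m) y)"
    and "x \<in> carrier X \<Longrightarrow> hnorm X ((D ^^ m) x) \<le> ((opnorm X T)\<^sup>2) ^ m * hnorm X x"
proof -
  have D: "D x \<in> carrier X" if "x \<in> carrier X" for x
    using that T by (auto simp: D_def)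
  have closed: "(D ^^ m) x \<in> carrier X" if "x \<in> carrier X" for m x
    using that by (induction m) (auto intro: D)
  then show "D ^^ m \<in> carrier X \<rightarrow> carrier X" by auto
  have sym: "hinner X (D x) y = hinner X x (D y)" if "x \<in> carrier X" "y \<in> carrier X" for x y
    using that T hinner_adj_left [of T "T x" y] hinner_adj [of T x "T y"] by (simp add: D_def)
  show "hinner X ((D ^^ m) x) y = hinner X x ((D ^^ m) y)" if "x \<in> carrier X" "y \<in> carrier X"
    using that
  proof (induction m arbitrary: y)
    case (Suc m)
    have "hinner X ((D ^^ Suc m) x) y = hinner X ((D ^^ m) x) (D y)"
      using Suc.prems closed by (simp add: sym)
    also have "\<dots> = hinner X x ((D ^^ m) (D y))"
      using Suc.prems D by (intro Suc.IH)
    finally show ?case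
      by (simp add: funpow_swap1 [of D m y])
  qed simp
  have norm: "hnorm X (D x) \<le> (opnorm X T)\<^sup>2 * hnorm X x" if x: "x \<in> carrier X" for x
  proof (cases "hnorm X (D x) = 0")
    case True
    then show ?thesis using x by simp
  next
    case False
    then have pos: "hnorm X (D x) > 0" using D [OF x] by (simp add: order_less_le)
    \<comment> \<open>Writing \<parallel>D x\<parallel>^2 as <T x, T (D x)> bounds \<open>D\<close>
      by the squared norm of \<open>T\<close> without estimating the adjoint.\<close>
    have "hnorm X (D x) * hnorm X (D x) = cmod (hinner X (D x) (D x))"
      using D [OF x] by (simp add: hinner_self norm_mult power2_eq_square)
    also have "\<dots> = cmod (hinner X (T x) (T (D x)))"
      using x D [OF x] T by (simp add: D_def hinner_adj_left)
    also have "\<dots> \<le> hnorm X (T x) * hnorm X (T (D x))"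
      using x D [OF x] T by (intro Cauchy_Schwarz) auto
    also have "\<dots> \<le> (opnorm X T * hnorm X x) * (opnorm X T * hnorm X (D x))"
      using x D [OF x] T by (intro mult_mono hnorm_le_opnorm) (auto simp: opnorm_nonneg)
    also have "\<dots> = ((opnorm X T)\<^sup>2 * hnorm X x) * hnorm X (D x)"
      by (simp add: power2_eq_square mult_ac)
    finally show ?thesis using pos by simp
  qed
  show "hnorm X ((D ^^ m) x) \<le> ((opnorm X T)\<^sup>2) ^ m * hnorm X x" if x: "x \<in> carrier X"
  proof (induction m)
    case (Suc m)
    have "hnorm X ((D ^^ Suc m) x) \<le> (opnorm X T)\<^sup>2 * hnorm X ((D ^^ m) x)"
      using norm closed x by simp
    also have "\<dots> \<le> (opnorm X T)\<^sup>2 * (((opnorm X T)\<^sup>2) ^ m * hnorm X x)"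
      by (intro mult_left_mono Suc) simp
    finally show ?case by (simp add: mult_ac)
  qed simp
qed

context hilbert_tensor
begin

text \<open>
  Power trick: with \<open>D = S\<^sup>* S\<close> and \<open>E = T\<^sup>* T\<close>, the norms \<open>a\<^sub>m\<close> of the image of a fixed
  algebraic tensor under \<open>D\<^sup>m \<otimes> E\<^sup>m\<close> satisfy \<open>a\<^sub>m\<^sup>2 \<le> a\<^sub>2\<^sub>m a\<^sub>0\<close>
  by self-adjointness, and the trivial bound on \<open>a\<^sub>m\<close> is good enough for the limit \<open>m \<rightarrow> \<infinity>\<close>.
\<close>

lemma hnorm_tensor_sum_map_le:
  assumes S: "S \<in> carrier (BO X)" and T: "T \<in> carrier (BO H)"
    and ps: "set ps \<subseteq> carrier X \<times> carrier H"
  shows "hnorm Z (tensor_sum (map (map_prod S T) ps)) \<le> opnorm X S * opnorm H T * hnorm Z (tensor_sum ps)"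
proof -
  define D where "D = (\<lambda>x. adj X S (S x))"
  define E where "E = (\<lambda>x. adj H T (T x))"
  note D = X.funpow_adj [OF S, folded D_def]
  note E = H.funpow_adj [OF T, folded E_def]
  define u where "u m = map (map_prod (D ^^ m) (E ^^ m)) ps" for m
  define a where "a m = hnorm Z (tensor_sum (u m))" for m
  define K where "K = (\<Sum>p\<leftarrow>ps. hnorm X (fst p) * hnorm H (snd p))"
  define c where "c = (opnorm X S)\<^sup>2 * (opnorm H T)\<^sup>2"
  have u: "set (u m) \<subseteq> carrier X \<times> carrier H" for m
    using ps D(1) [of m] E(1) [of m] by (auto simp: u_def)
  have u0: "u 0 = ps" by (simp add: u_def prod.map_id0)
  have "a 1 \<le> c * a 0"
  proof (rule le_mult_if_square_le)
    show "0 \<le> a m" for m using u by (simp add: a_def)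
    show "(a m)\<^sup>2 \<le> a (2 * m) * a 0" for m
    proof -
      have "map (map_prod (D ^^ m) (E ^^ m)) (u m) = u (2 * m)"
        by (auto simp: u_def mult_2 funpow_add)
      then have "hinner Z (tensor_sum (u m)) (tensor_sum (u m)) = hinner Z (tensor_sum (u 0)) (tensor_sum (u (2 * m)))"
        using hinner_tensor_sum_map [OF ps u D(1) D(1) D(2) E(1) E(1) E(2), of m m m]
        by (simp add: u_def [of m] u0)
      moreover have "(a m)\<^sup>2 = cmod (hinner Z (tensor_sum (u m)) (tensor_sum (u m)))"
        using u by (simp add: a_def Z.hinner_self norm_power)
      ultimately show ?thesis
        using Z.Cauchy_Schwarz [of "tensor_sum (u 0)" "tensor_sum (u (2 * m))"] u
        by (simp add: a_def mult.commute)
    qed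
    show "a m \<le> K * c ^ m" for m
    proof -
      have "a m \<le> (\<Sum>p\<leftarrow>u m. hnorm X (fst p) * hnorm H (snd p))"
        unfolding a_def by (rule hnorm_tensor_sum_le [OF u])
      also have "\<dots> = (\<Sum>p\<leftarrow>ps. hnorm X ((D ^^ m) (fst p)) * hnorm H ((E ^^ m) (snd p)))"
        by (simp add: u_def o_def)
      also have "\<dots> \<le> (\<Sum>p\<leftarrow>ps. (hnorm X (fst p) * hnorm H (snd p)) * c ^ m)"
      proof (rule sum_list_mono)
        fix p assume "p \<in> set ps"
        then have p: "fst p \<in> carrier X" "snd p \<in> carrier H" using ps by auto
        have "hnorm X ((D ^^ m) (fst p)) * hnorm H ((E ^^ m) (snd p))
            \<le> (((opnorm X S)\<^sup>2) ^ m * hnorm X (fst p)) * (((opnorm H T)\<^sup>2) ^ m * hnorm H (snd p))"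
          using D(1) [of m] E(1) [of m] p
          by (intro mult_mono D(3) E(3)) (auto simp: Pi_iff)
        then show "hnorm X ((D ^^ m) (fst p)) * hnorm H ((E ^^ m) (snd p))
            \<le> (hnorm X (fst p) * hnorm H (snd p)) * c ^ m"
          by (simp add: c_def power_mult_distrib mult_ac)
      qed
      also have "\<dots> = K * c ^ m"
        by (simp add: K_def sum_list_mult_const)
      finally show ?thesis .
    qed
    show "0 \<le> c" by (simp add: c_def)
  qed
  let ?v = "map (map_prod S T) ps"
  have v: "set ?v \<subseteq> carrier X \<times> carrier H" using ps S T by auto
  \<comment> \<open>The squared norm of the image under S \<otimes> T is the pairing of the original
    sum with \<open>u 1\<close>; hence a 1 \<le> c a 0 yields the claim after a square root,
    \<open>c\<close> being the square of the wanted constant.\<close>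
  have "map (map_prod (adj X S) (adj H T)) ?v = u 1"
    by (auto simp: u_def D_def E_def)
  then have "hinner Z (tensor_sum ?v) (tensor_sum ?v) = hinner Z (tensor_sum (u 0)) (tensor_sum (u 1))"
    using hinner_tensor_sum_map [OF ps v, of S "adj X S" T "adj H T"] S T u0
    by (simp add: X.hinner_adj H.hinner_adj Pi_iff)
  then have "(hnorm Z (tensor_sum ?v))\<^sup>2 \<le> a 0 * a 1"
    using Z.Cauchy_Schwarz [of "tensor_sum (u 0)" "tensor_sum (u 1)"] u v
      Z.hinner_self [of "tensor_sum ?v"]
    by (metis a_def norm_of_real abs_power2 tensor_sum_closed)
  also have "\<dots> \<le> a 0 * (c * a 0)"
    using \<open>a 1 \<le> c * a 0\<close> u by (intro mult_left_mono) (auto simp: a_def)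
  also have "\<dots> = (opnorm X S * opnorm H T * hnorm Z (tensor_sum ps))\<^sup>2"
    by (simp add: c_def a_def u0 power2_eq_square mult_ac)
  finally show ?thesis
    using ps S T
    by (intro power2_le_imp_le [of "hnorm Z (tensor_sum ?v)"])
      (auto simp: X.opnorm_nonneg H.opnorm_nonneg)
qed

text \<open>\<open>R\<close> pairs each finite sum with its termwise image. Two representations of
  one vector get equal images because the cross-norm bound of \<open>hnorm_tensor_sum_map_le\<close>
  depends only on the vector.\<close>

lemma tensor_op_exists:
  assumes S: "S \<in> carrier (BO X)" and T: "T \<in> carrier (BO H)"
  shows "\<exists>B\<in>carrier (BO Z). (\<forall>x\<in>carrier X. \<forall>h\<in>carrier H. B (t x h) = t (S x) (T h)) \<and>
    (\<forall>z\<in>carrier Z. hnorm Z (B z) \<le> opnorm X S * opnorm H T * hnorm Z z)"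
proof -
  let ?m = "map (map_prod S T)"
  define R where "R = {(tensor_sum ps, tensor_sum (?m ps)) |ps. set ps \<subseteq> carrier X \<times> carrier H}"
  have m: "set (?m ps) \<subseteq> carrier X \<times> carrier H" if "set ps \<subseteq> carrier X \<times> carrier H" for ps
    using that S T by auto
  have "\<exists>B\<in>carrier (BO Z). (\<forall>(a, b)\<in>R. B a = b) \<and>
      (\<forall>z\<in>carrier Z. hnorm Z (B z) \<le> opnorm X S * opnorm H T * hnorm Z z)"
  proof (rule Z.bounded_linear_relation_extends)
    show "R \<subseteq> carrier Z \<times> carrier Z"
      using m by (auto simp: R_def)
    show "(a \<oplus>\<^bsub>Z\<^esub> c, b \<oplus>\<^bsub>Z\<^esub> d) \<in> R" if R: "(a, b) \<in> R" "(c, d) \<in> R" for a b c d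
    proof -
      obtain ps qs where "a = tensor_sum ps" "b = tensor_sum (?m ps)" "c = tensor_sum qs" "d = tensor_sum (?m qs)"
        "set ps \<subseteq> carrier X \<times> carrier H" "set qs \<subseteq> carrier X \<times> carrier H"
        using R by (auto simp: R_def)
      then show ?thesis
        using tensor_sum_append [of ps qs] tensor_sum_append [OF m m, of ps qs]
        by (auto simp: R_def intro!: exI [of _ "ps @ qs"])
    qed
    show "(c \<odot>\<^bsub>Z\<^esub> a, c \<odot>\<^bsub>Z\<^esub> b) \<in> R" if R: "(a, b) \<in> R" for a b c
    proof -
      obtain ps where ps: "a = tensor_sum ps" "b = tensor_sum (?m ps)" "set ps \<subseteq> carrier X \<times> carrier H"
        using R by (auto simp: R_def)
      let ?c = "map (map_prod (\<lambda>x. c \<odot>\<^bsub>X\<^esub> x) id)"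
      have "?m (?c ps) = ?c (?m ps)"
        using ps(3) S by (auto simp: X.BO_homogeneous)
      moreover have "set (?c ps) \<subseteq> carrier X \<times> carrier H"
        using ps(3) by auto
      ultimately show ?thesis
        using tensor_sum_smult [OF ps(3), of c] tensor_sum_smult [OF m [OF ps(3)], of c] ps
        unfolding R_def by (smt (verit, best) mem_Collect_eq)
    qed
    show "hnorm Z b \<le> opnorm X S * opnorm H T * hnorm Z a" if "(a, b) \<in> R" for a b
      using that hnorm_tensor_sum_map_le [OF S T] by (auto simp: R_def)
    show "0 \<le> opnorm X S * opnorm H T"
      using S T by (simp add: X.opnorm_nonneg H.opnorm_nonneg)
    show "\<exists>(a, b)\<in>R. hnorm Z (z \<ominus>\<^bsub>Z\<^esub> a) < e" if "z \<in> carrier Z" "0 < e" for z e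
      using tensor_sum_dense [OF that] by (auto simp: R_def)
  qed
  then obtain B where B: "B \<in> carrier (BO Z)" "\<forall>(a, b)\<in>R. B a = b"
    "\<forall>z\<in>carrier Z. hnorm Z (B z) \<le> opnorm X S * opnorm H T * hnorm Z z"
    by blast
  have "B (t x h) = t (S x) (T h)" if "x \<in> carrier X" "h \<in> carrier H" for x h
  proof -
    have "(tensor_sum [(x, h)], tensor_sum (?m [(x, h)])) \<in> R"
      using that unfolding R_def by fastforce
    then show ?thesis
      using B(2) that S T by (auto simp: tensor_closed)
  qed
  then show ?thesis using B by blast
qed

text \<open>The difference of the operators vanishes on finite tensor sums by additivity and
  everywhere by boundedness and density. This is the uniqueness half of
  \<open>tensor_op\<close>.\<close>

lemma BO_tensor_ext:
  assumes B: "B \<in> carrier (BO Z)" and C: "C \<in> carrier (BO Z)"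
    and eq: "\<And>x h. \<lbrakk>x \<in> carrier X; h \<in> carrier H\<rbrakk> \<Longrightarrow> B (t x h) = C (t x h)"
  shows "B = C"
proof (rule Z.BO_ext)
  fix z assume z: "z \<in> carrier Z"
  define D where "D = B \<ominus>\<^bsub>BO Z\<^esub> C"
  have D: "D \<in> carrier (BO Z)" using B C by (simp add: D_def)
  have D0: "D (t x h) = \<zero>\<^bsub>Z\<^esub>" if "x \<in> carrier X" "h \<in> carrier H" for x h
    using that B C by (simp add: D_def eq tensor_closed Z.M.minus_eq Z.M.r_neg)
  have Dz: "D \<zero>\<^bsub>Z\<^esub> = \<zero>\<^bsub>Z\<^esub>"
    using Z.hnorm_le_opnorm [OF D, of "\<zero>\<^bsub>Z\<^esub>"] Z.hnorm_le_0_iff [of "D \<zero>\<^bsub>Z\<^esub>"] D by auto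
  have D_sum: "D (tensor_sum ps) = \<zero>\<^bsub>Z\<^esub>" if "set ps \<subseteq> carrier X \<times> carrier H" for ps
    using that
  proof (induction ps)
    case (Cons p ps)
    then show ?case
      using D D0 [of "fst p" "snd p"] by (auto simp: Z.BO_additive tensor_closed)
  qed (simp add: Dz)
  have "hnorm Z (D z) \<le> e" if e: "0 < e" for e
  proof -
    let ?M = "opnorm Z D"
    have M: "0 \<le> ?M" using D by (rule Z.opnorm_nonneg)
    \<comment> \<open>The denominator ?M + 1 stays positive when the norm of \<open>D\<close> is
      zero.\<close>
    obtain ps where ps: "set ps \<subseteq> carrier X \<times> carrier H"
      "hnorm Z (z \<ominus>\<^bsub>Z\<^esub> tensor_sum ps) < e / (?M + 1)"
      using tensor_sum_dense [OF z, of "e / (?M + 1)"] e M by auto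
    have "z = tensor_sum ps \<oplus>\<^bsub>Z\<^esub> (z \<ominus>\<^bsub>Z\<^esub> tensor_sum ps)"
      using z ps by (intro Z.hinner_ext) (auto simp: Z.hinner_simps)
    then have "D z = D (tensor_sum ps) \<oplus>\<^bsub>Z\<^esub> D (z \<ominus>\<^bsub>Z\<^esub> tensor_sum ps)"
      using D z ps by (metis Z.BO_additive Z.M.minus_closed tensor_sum_closed)
    then have "hnorm Z (D z) = hnorm Z (D (z \<ominus>\<^bsub>Z\<^esub> tensor_sum ps))"
      using D_sum [OF ps(1)] D z ps(1) by simp
    also have "\<dots> \<le> ?M * hnorm Z (z \<ominus>\<^bsub>Z\<^esub> tensor_sum ps)"
      using z ps D by (intro Z.hnorm_le_opnorm) auto
    also have "\<dots> \<le> ?M * (e / (?M + 1))"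
      using ps M by (intro mult_left_mono) auto
    also have "\<dots> \<le> e"
      using M e by (simp add: field_simps)
    finally show ?thesis .
  qed
  then have "hnorm Z (D z) \<le> 0"
    using field_le_epsilon [of "hnorm Z (D z)" 0] by simp
  then have "D z = \<zero>\<^bsub>Z\<^esub>"
    using D z by (simp add: Z.hnorm_le_0_iff)
  then have "hinner Z (D z) v = 0" if "v \<in> carrier Z" for v
    using that by simp
  then show "B z = C z"
    using B C z by (intro Z.hinner_ext) (auto simp: D_def Z.hinner_simps)
qed (use B C in auto)

lemma
  assumes S: "S \<in> carrier (BO X)" and T: "T \<in> carrier (BO H)"
  shows tensor_op_closed [simp, intro]: "tensor_op X H Z t S T \<in> carrier (BO Z)"
    and tensor_op_apply: "\<lbrakk>x \<in> carrier X; h \<in> carrier H\<rbrakk> \<Longrightarrow> tensor_op X H Z t S T (t x h) = t (S x) (T h)"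
    and hnorm_tensor_op_le:
      "z \<in> carrier Z \<Longrightarrow> hnorm Z (tensor_op X H Z t S T z) \<le> opnorm X S * opnorm H T * hnorm Z z"
proof -
  let ?P = "\<lambda>B. B \<in> carrier (BO Z) \<and> (\<forall>x\<in>carrier X. \<forall>h\<in>carrier H. B (t x h) = t (S x) (T h))"
  obtain B where B: "?P B" "\<forall>z\<in>carrier Z. hnorm Z (B z) \<le> opnorm X S * opnorm H T * hnorm Z z"
    using tensor_op_exists [OF S T] by blast
  have "tensor_op X H Z t S T = B"
    unfolding tensor_op_def
  proof (rule the_equality)
    show "?P B" by (rule B)
    show "C = B" if "?P C" for C
      using that B by (intro BO_tensor_ext) auto
  qed
  then show "tensor_op X H Z t S T \<in> carrier (BO Z)"
    and "\<lbrakk>x \<in> carrier X; h \<in> carrier H\<rbrakk> \<Longrightarrow> tensor_op X H Z t S T (t x h) = t (S x) (T h)"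
    and "z \<in> carrier Z \<Longrightarrow> hnorm Z (tensor_op X H Z t S T z) \<le> opnorm X S * opnorm H T * hnorm Z z"
    using B by auto
qed

lemma tensor_op_eqI:
  assumes "S \<in> carrier (BO X)" "T \<in> carrier (BO H)" "B \<in> carrier (BO Z)"
    and "\<And>x h. \<lbrakk>x \<in> carrier X; h \<in> carrier H\<rbrakk> \<Longrightarrow> B (t x h) = t (S x) (T h)"
  shows "tensor_op X H Z t S T = B"
  using assms by (intro BO_tensor_ext) (auto simp: tensor_op_apply)

end

section \<open>Coefficients of functions with positive real part\<close>

text \<open>A Fourier coefficient as a limit of means over roots of unity. The mean of the phase
  with frequency l + m is 1 when l + m = 0 and otherwise vanishes for large N, so only m = -l
  survives; no such m exists for l > 0. \<open>Suc N\<close> points keep every mean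
  nonempty.\<close>

lemma circle_mean_tendsto:
  fixes b :: "nat \<Rightarrow> complex" and l :: int
  assumes b: "summable (\<lambda>m. norm (b m))"
  defines "\<theta> \<equiv> \<lambda>N j. 2 * pi * real j / real (Suc N)"
  shows "(\<lambda>N. (\<Sum>j<Suc N. cis (of_int l * \<theta> N j) * (\<Sum>m. b m * cis (\<theta> N j) ^ m)) / of_nat (Suc N))
    \<longlonglongrightarrow> (if l \<le> 0 then b (nat (- l)) else 0)"
proof -
  define g where "g N m = (\<Sum>j<Suc N. cis (of_int (l + int m) * \<theta> N j)) / of_nat (Suc N)" for N m
  have g_norm: "norm (g N m) \<le> 1" for N m
  proof -
    have "norm (\<Sum>j<Suc N. cis (of_int (l + int m) * \<theta> N j)) \<le> real (Suc N)"
      by (rule order_trans [OF norm_sum]) simp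
    then show ?thesis by (simp add: g_def norm_divide del: of_nat_Suc sum.lessThan_Suc)
  qed
  have g_lim: "(\<lambda>N. g N m) \<longlonglongrightarrow> (if l + int m = 0 then 1 else 0)" for m
  proof (cases "l + int m = 0")
    case True
    then have "g N m = 1" for N
      by (simp add: g_def del: of_nat_Suc sum.lessThan_Suc)
    then show ?thesis using True by simp
  next
    case False
    \<comment> \<open>Once Suc N exceeds \<bar>l + m\<bar> > 0, it cannot divide l + m. So
      \<open>w\<close> is a root of unity other than 1 and its geometric sum is zero.\<close>
    have "g N m = 0" if N: "nat \<bar>l + int m\<bar> \<le> N" for N
    proof -
      define w where "w = cis (of_int (l + int m) * (2 * pi / real (Suc N)))"
      have w_pow: "cis (of_int (l + int m) * \<theta> N j) = w ^ j" for j
        unfolding w_def \<theta>_def Complex.DeMoivre by (rule arg_cong [of _ _ cis]) simp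
      have "w ^ Suc N = cis (2 * pi * of_int (l + int m))"
        unfolding w_def Complex.DeMoivre by (simp add: field_simps del: of_nat_Suc of_int_add)
      also have "\<dots> = 1" by (rule cis_multiple_2pi) simp
      finally have w1: "w ^ Suc N = 1" .
      have "w \<noteq> 1"
      proof
        assume "w = 1"
        then have "cos (of_int (l + int m) * (2 * pi / real (Suc N))) = 1"
          by (simp add: w_def complex_eq_iff)
        then obtain i :: int where "of_int (l + int m) * (2 * pi / real (Suc N)) = of_int i * 2 * pi"
          using cos_one_2pi_int by blast
        then have "(2 * pi) * real_of_int (l + int m) = (2 * pi) * (real_of_int i * real (Suc N))"
          by (simp add: field_simps del: of_nat_Suc of_int_add)
        then have "real_of_int (l + int m) = real_of_int (i * int (Suc N))"
          by (subst (asm) mult_left_cancel) simp_all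
        then have i: "l + int m = i * int (Suc N)"
          by (simp only: of_int_eq_iff)
        then have "i \<noteq> 0" using False by auto
        then have "int (Suc N) \<le> \<bar>i\<bar> * int (Suc N)" by simp
        also have "\<dots> = \<bar>l + int m\<bar>" using i by (simp add: abs_mult)
        finally show False using N by linarith
      qed
      then have "(\<Sum>j<Suc N. w ^ j) = 0"
        using w1 by (simp add: geometric_sum del: sum.lessThan_Suc power_Suc)
      then show ?thesis
        by (simp only: g_def w_pow div_0)
    qed
    then have "\<forall>\<^sub>F N in sequentially. g N m = 0"
      by (auto simp: eventually_sequentially)
    then show ?thesis using False by (simp add: tendsto_eventually)
  qed
  have swap: "(\<Sum>j<Suc N. cis (of_int l * \<theta> N j) * (\<Sum>m. b m * cis (\<theta> N j) ^ m)) / of_nat (Suc N)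
      = (\<Sum>m. b m * g N m)" for N
  proof -
    have sm: "summable (\<lambda>m. b m * cis (\<theta> N j) ^ m)" for j
      using b by (intro summable_norm_cancel [of "\<lambda>m. b m * cis (\<theta> N j) ^ m"])
        (simp add: norm_mult norm_power)
    have phase: "cis (of_int l * \<theta> N j) * (b m * cis (\<theta> N j) ^ m)
        = b m * cis (of_int (l + int m) * \<theta> N j)" for j m
      by (simp add: Complex.DeMoivre cis_mult distrib_right)
    have "(\<Sum>j<Suc N. cis (of_int l * \<theta> N j) * (\<Sum>m. b m * cis (\<theta> N j) ^ m))
        = (\<Sum>j<Suc N. \<Sum>m. cis (of_int l * \<theta> N j) * (b m * cis (\<theta> N j) ^ m))"
      by (intro sum.cong refl suminf_mult [symmetric] sm)
    also have "\<dots> = (\<Sum>m. \<Sum>j<Suc N. cis (of_int l * \<theta> N j) * (b m * cis (\<theta> N j) ^ m))"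
      by (intro suminf_sum [symmetric] summable_mult sm)
    also have "\<dots> / of_nat (Suc N)
        = (\<Sum>m. (\<Sum>j<Suc N. cis (of_int l * \<theta> N j) * (b m * cis (\<theta> N j) ^ m)) / of_nat (Suc N))"
      by (intro suminf_divide [symmetric] summable_sum summable_mult sm)
    also have "\<dots> = (\<Sum>m. b m * g N m)"
      by (simp only: phase g_def sum_distrib_left [symmetric] times_divide_eq_right)
    finally show ?thesis .
  qed
  \<comment> \<open>Tannery's theorem is dominated convergence for series; the majorant is norm (b
    m), since the means have modulus at most 1.\<close>
  have lim: "(\<lambda>N. \<Sum>m. b m * g N m) \<longlonglongrightarrow> (\<Sum>m. b m * (if l + int m = 0 then 1 else 0))"
  proof (rule tannerys_theorem [THEN conjunct2, THEN conjunct2])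
    show "((\<lambda>N. b m * g N m) \<longlonglongrightarrow> b m * (if l + int m = 0 then 1 else 0))" for m
      by (intro tendsto_mult tendsto_const g_lim)
    have "norm (b m * g N m) \<le> norm (b m)" for m N
      using mult_left_le [OF g_norm, of "norm (b m)" N m] by (simp add: norm_mult)
    then show "\<forall>\<^sub>F (m, N) in at_top \<times>\<^sub>F sequentially. norm (b m * g N m) \<le> norm (b m)"
      by (auto intro!: always_eventually)
  qed (use b in auto)
  have "(\<Sum>m. b m * (if l + int m = 0 then 1 else 0)) = (if l \<le> 0 then b (nat (- l)) else 0)"
  proof (cases "l \<le> 0")
    case True
    have "(\<Sum>m. b m * (if l + int m = 0 then 1 else 0)) = (\<Sum>m. if m = nat (- l) then b m else 0)"
      using True by (intro suminf_cong) auto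
    then show ?thesis
      using True sums_unique [OF sums_single [of "nat (- l)" b]] by simp
  next
    case False
    then have "b m * (if l + int m = 0 then 1 else 0) = 0" for m by auto
    then show ?thesis using False by simp
  qed
  then show ?thesis using lim by (simp only: swap)
qed

text \<open>
  A power series with positive real part \<open>V\<close> is tested on \<open>x + c y\<close> at \<open>z = s e\<^sup>i\<^sup>\<theta>\<close> with the
  phase \<open>c = e\<^sup>i\<^sup>k\<^sup>\<theta>\<close>; averaging over \<open>\<theta>\<close> isolates the off-diagonal coefficient
  \<open>\<langle>G\<^sub>k x, y\<rangle>\<close>, which gives the operator norm and not only the numerical radius of \<open>G\<^sub>k\<close>.
\<close>

lemma (in hilbert_space) positive_real_part_coefficient_bound:
  assumes G: "\<And>m. G m \<in> carrier (BO X)"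
    and V: "\<And>z. cmod z < 1 \<Longrightarrow> V z \<in> carrier (BO X)"
    and V_sums: "\<And>z x y. \<lbrakk>cmod z < 1; x \<in> carrier X; y \<in> carrier X\<rbrakk>
      \<Longrightarrow> (\<lambda>m. hinner X (G m x) y * z ^ m) sums hinner X (V z x) y"
    and V_pos: "\<And>z x. \<lbrakk>cmod z < 1; x \<in> carrier X\<rbrakk> \<Longrightarrow> 0 \<le> Re (hinner X (V z x) x)"
    and G0: "\<And>x. x \<in> carrier X \<Longrightarrow> Re (hinner X (G 0 x) x) \<le> d * (hnorm X x)\<^sup>2"
    and k: "1 \<le> k" and x: "x \<in> carrier X"
  shows "hnorm X (G k x) \<le> 2 * d * hnorm X x"
proof -
  define g where "g x y m = hinner X (G m x) y" for x y m
  have mean: "0 \<le> Re (g x x 0 + g y y 0 + g x y k * of_real s ^ k)"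
    if s: "0 < s" "s < 1" and y: "y \<in> carrier X" for s y
  proof -
    define \<theta> where "\<theta> N j = 2 * pi * real j / real (Suc N)" for N j
    define b where "b x y m = g x y m * of_real s ^ m" for x y m
    have b: "summable (\<lambda>m. norm (b x y m))" if "x \<in> carrier X" "y \<in> carrier X" for x y
    proof -
      \<comment> \<open>Convergence at the larger radius (s + 1)/2 < 1 gives absolute convergence on
        the circle of radius \<open>s\<close>.\<close>
      have "summable (\<lambda>m. g x y m * of_real ((s + 1) / 2) ^ m)"
        using V_sums [of "of_real ((s + 1) / 2)" x y] that s
        by (auto simp: g_def sums_iff norm_divide simp flip: of_real_add of_real_divide)
      then show ?thesis
        unfolding b_def by (rule powser_insidea) (use s in simp)
    qed
    define M where "M l x y N = (\<Sum>j<Suc N. cis (of_int l * \<theta> N j) * (\<Sum>m. b x y m * cis (\<theta> N j) ^ m))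
      / of_nat (Suc N)" for l x y N
    have M_lim: "M l x y \<longlonglongrightarrow> (if l \<le> 0 then b x y (nat (- l)) else 0)"
      if "x \<in> carrier X" "y \<in> carrier X" for l x y
      unfolding M_def \<theta>_def by (rule circle_mean_tendsto [OF b [OF that]])
    \<comment> \<open>The mixed term with \<open>y\<close> and \<open>x\<close> exchanged contains
      only frequencies k + m \<ge> 1 and averages to zero; the other mixed term keeps exactly its
      coefficient of index \<open>k\<close>.\<close>
    have "(\<lambda>N. Re (M 0 x x N + M (int k) y x N + M (- int k) x y N + M 0 y y N))
        \<longlonglongrightarrow> Re (b x x 0 + 0 + b x y k + b y y 0)"
      using M_lim [OF x x, of 0] M_lim [OF y x, of "int k"] M_lim [OF x y, of "- int k"]
        M_lim [OF y y, of 0] k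
      by (intro tendsto_Re tendsto_add) (auto split: if_splits)
    moreover have "0 \<le> Re (M 0 x x N + M (int k) y x N + M (- int k) x y N + M 0 y y N)" for N
    proof -
      have pos: "0 \<le> Re (cis (of_int 0 * \<theta> N j) * (\<Sum>m. b x x m * cis (\<theta> N j) ^ m)
          + cis (of_int (int k) * \<theta> N j) * (\<Sum>m. b y x m * cis (\<theta> N j) ^ m)
          + cis (of_int (- int k) * \<theta> N j) * (\<Sum>m. b x y m * cis (\<theta> N j) ^ m)
          + cis (of_int 0 * \<theta> N j) * (\<Sum>m. b y y m * cis (\<theta> N j) ^ m))" for j
      proof -
        define z where "z = of_real s * cis (\<theta> N j)"
        define c where "c = cis (real k * \<theta> N j)"
        have z: "cmod z < 1" using s by (simp add: z_def norm_mult)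
        have c: "c * cnj c = 1" by (simp add: c_def cis_cnj cis_mult)
        have val: "(\<Sum>m. b x y m * cis (\<theta> N j) ^ m) = hinner X (V z x) y"
          if "x \<in> carrier X" "y \<in> carrier X" for x y
          using V_sums [OF z that]
          by (simp add: b_def g_def z_def power_mult_distrib mult.assoc sums_iff)
        have "hinner X (V z (x \<oplus> c \<odot> y)) (x \<oplus> c \<odot> y)
            = hinner X (V z x) x + c * hinner X (V z y) x + cnj c * hinner X (V z x) y
              + c * cnj c * hinner X (V z y) y"
          using V [OF z] x y by (simp add: BO_additive BO_homogeneous hinner_simps algebra_simps)
        then show ?thesis
          using V_pos [OF z, of "x \<oplus> c \<odot> y"] x y
          by (simp add: val c) (simp add: c_def cis_cnj)
      qed
      have "M 0 x x N + M (int k) y x N + M (- int k) x y N + M 0 y y N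
        = (\<Sum>j<Suc N. cis (of_int 0 * \<theta> N j) * (\<Sum>m. b x x m * cis (\<theta> N j) ^ m)
          + cis (of_int (int k) * \<theta> N j) * (\<Sum>m. b y x m * cis (\<theta> N j) ^ m)
          + cis (of_int (- int k) * \<theta> N j) * (\<Sum>m. b x y m * cis (\<theta> N j) ^ m)
          + cis (of_int 0 * \<theta> N j) * (\<Sum>m. b y y m * cis (\<theta> N j) ^ m)) / of_nat (Suc N)"
        unfolding M_def by (simp only: sum.distrib add_divide_distrib)
      then show ?thesis
        using pos by (simp only: Re_divide_of_nat Re_sum) (intro divide_nonneg_nonneg sum_nonneg, auto)
    qed
    ultimately have "0 \<le> Re (b x x 0 + 0 + b x y k + b y y 0)"
      by (meson LIMSEQ_le_const)
    then show ?thesis by (simp add: b_def add_ac)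
  qed
  \<comment> \<open>The averaged inequality is polynomial in \<open>s\<close>, so it survives s
    \<rightarrow> 1 although the series were only summed for s < 1.\<close>
  have limit: "0 \<le> d * ((hnorm X x)\<^sup>2 + (hnorm X y)\<^sup>2) + Re (g x y k)" if y: "y \<in> carrier X" for y
  proof -
    have ev: "\<forall>\<^sub>F s in at_left (1::real). 0 < s \<and> s < 1"
      using eventually_at_left_real [of 0 1] by simp
    have "((\<lambda>s. Re (g x x 0 + g y y 0 + g x y k * of_real s ^ k))
        \<longlongrightarrow> Re (g x x 0 + g y y 0 + g x y k * of_real 1 ^ k)) (at_left 1)"
      by (intro tendsto_intros)
    then have "0 \<le> Re (g x x 0 + g y y 0 + g x y k * of_real 1 ^ k)"
      using eventually_mono [OF ev] mean [OF _ _ y]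
      by (intro tendsto_lowerbound [of _ _ "at_left (1::real)"]) (auto elim!: eventually_mono [rotated])
    then show ?thesis
      using G0 [OF x] G0 [OF y] by (simp add: g_def distrib_left)
  qed
  show ?thesis
  proof (cases "hnorm X x = 0 \<or> hnorm X (G k x) = 0")
    case True
    \<comment> \<open>\<open>d\<close> has no assumed sign; taking y = 0 in \<open>limit\<close>
      gives what the degenerate case requires.\<close>
    moreover have "0 \<le> d * (hnorm X x)\<^sup>2"
      using limit [of \<zero>] x by (simp add: g_def G)
    then have "0 \<le> d * hnorm X x"
      using x by (cases "hnorm X x = 0") (auto simp: zero_le_mult_iff order_less_le)
    ultimately show ?thesis
      using hnorm_le_opnorm [OF G [of k] x] by auto
  next
    case False
    define r where "r = hnorm X x / hnorm X (G k x)"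
    have Gx: "G k x \<in> carrier X" using G x by blast
    have pos: "0 < hnorm X x" "0 < hnorm X (G k x)"
      using False x Gx by (auto simp: order_less_le)
    \<comment> \<open>\<open>y\<close> is the negative of G_k x rescaled to the norm of
      \<open>x\<close>: then \<open>limit\<close> reads \<parallel>x\<parallel> \<parallel>G_k
      x\<parallel> \<le> 2 d \<parallel>x\<parallel>^2.\<close>
    define y where "y = of_real (- r) \<odot> G k x"
    have y: "y \<in> carrier X" using Gx by (simp add: y_def)
    have "hnorm X y = hnorm X x"
      using pos Gx by (simp add: y_def hnorm_smult r_def norm_divide del: of_real_minus)
    moreover have "Re (g x y k) = - (hnorm X x * hnorm X (G k x))"
      using Gx pos
      by (simp add: g_def y_def hinner_simps hinner_self r_def power2_eq_square)
    ultimately have "hnorm X (G k x) * hnorm X x \<le> 2 * d * hnorm X x * hnorm X x"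
      using limit [OF y] by (simp add: power2_eq_square mult_ac)
    then show ?thesis using pos by simp
  qed
qed

section \<open>Homogeneous parts and the Bohr inequality\<close>

context hilbert_space
begin

lemma opnorm_one_le: "opnorm X \<one>\<^bsub>BO X\<^esub> \<le> 1"
  by (rule opnorm_le) auto

lemma row_square_closed:
  assumes "T \<in> {1..n} \<rightarrow> carrier (BO X)"
  shows "row_square n X T \<in> carrier (BO X)"
  unfolding row_square_def using assms by (intro BO.finsum_closed) (auto simp: Pi_iff)

lemma row_square_smult:
  assumes T: "T \<in> {1..n} \<rightarrow> carrier (BO X)"
  shows "row_square n X (\<lambda>i. c \<odot>\<^bsub>BO X\<^esub> T i) = of_real ((cmod c)\<^sup>2) \<odot>\<^bsub>BO X\<^esub> row_square n X T"
proof (rule BO_ext_inner)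
  have cT: "(\<lambda>i. c \<odot>\<^bsub>BO X\<^esub> T i) \<in> {1..n} \<rightarrow> carrier (BO X)" using T by auto
  then show "row_square n X (\<lambda>i. c \<odot>\<^bsub>BO X\<^esub> T i) \<in> carrier (BO X)"
    by (rule row_square_closed)
  show "of_real ((cmod c)\<^sup>2) \<odot>\<^bsub>BO X\<^esub> row_square n X T \<in> carrier (BO X)"
    using row_square_closed [OF T] by blast
  fix x y assume x: "x \<in> carrier X" and y: "y \<in> carrier X"
  have cc: "c * cnj c = of_real ((cmod c)\<^sup>2)" by (rule complex_norm_square [symmetric])
  have row: "hinner X (row_square n X S x) y = (\<Sum>i\<in>{1..n}. hinner X (S i (adj X (S i) x)) y)"
    if "S \<in> {1..n} \<rightarrow> carrier (BO X)" for S
  proof -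
    have "(\<lambda>i. S i \<otimes>\<^bsub>BO X\<^esub> adj X (S i)) \<in> {1..n} \<rightarrow> carrier (BO X)"
      using that by (auto simp: Pi_iff)
    then show ?thesis
      unfolding row_square_def using x y by (simp add: hinner_BO_finsum)
  qed
  have "hinner X ((c \<odot>\<^bsub>BO X\<^esub> T i) (adj X (c \<odot>\<^bsub>BO X\<^esub> T i) x)) y
      = of_real ((cmod c)\<^sup>2) * hinner X (T i (adj X (T i) x)) y" if "i \<in> {1..n}" for i
  proof -
    have Ti: "T i \<in> carrier (BO X)" using T that by auto
    then show ?thesis
      using x y cc by (simp add: adj_smult hinner_simps BO_homogeneous mult.commute [of "cnj c" c])
  qed
  then have "hinner X (row_square n X (\<lambda>i. c \<odot>\<^bsub>BO X\<^esub> T i) x) y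
      = of_real ((cmod c)\<^sup>2) * hinner X (row_square n X T x) y"
    unfolding row [OF cT] row [OF T] by (simp add: sum_distrib_left)
  then show "hinner X (row_square n X (\<lambda>i. c \<odot>\<^bsub>BO X\<^esub> T i) x) y
      = hinner X ((of_real ((cmod c)\<^sup>2) \<odot>\<^bsub>BO X\<^esub> row_square n X T) x) y"
    using x y row_square_closed [OF T] by (simp add: hinner_simps)
qed

lemma closed_row_ball_smult:
  assumes T: "T \<in> closed_row_ball n X r" and r: "0 \<le> r" and c: "cmod c * r < 1"
  shows "(\<lambda>i. c \<odot>\<^bsub>BO X\<^esub> T i) \<in> open_row_ball n X"
proof -
  have T': "T \<in> {1..n} \<rightarrow> carrier (BO X)" and "sqrt (opnorm X (row_square n X T)) \<le> r"
    using T by (auto simp: closed_row_ball_def)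
  then have "opnorm X (row_square n X T) \<le> r\<^sup>2"
    by (simp add: sqrt_le_D)
  have "opnorm X (row_square n X (\<lambda>i. c \<odot>\<^bsub>BO X\<^esub> T i)) \<le> (cmod c)\<^sup>2 * opnorm X (row_square n X T)"
    using opnorm_smult_le [OF row_square_closed [OF T'], of "of_real ((cmod c)\<^sup>2)"]
    by (simp add: row_square_smult [OF T'] norm_power)
  also have "\<dots> \<le> (cmod c)\<^sup>2 * r\<^sup>2"
    by (intro mult_left_mono \<open>opnorm X (row_square n X T) \<le> r\<^sup>2\<close>) simp
  also have "\<dots> = (cmod c * r)\<^sup>2"
    by (simp add: power_mult_distrib)
  also have "\<dots> < 1"
    using c r by (simp add: abs_square_less_1 abs_mult)
  finally show ?thesis using T' by (auto simp: open_row_ball_def)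
qed

lemma word_op_closed:
  assumes T: "T \<in> {1..n} \<rightarrow> carrier (BO X)" and \<alpha>: "\<alpha> \<in> lists {1..n}"
  shows "word_op X T \<alpha> \<in> carrier (BO X)"
  using \<alpha> T by (induction \<alpha>) (auto simp: word_op_def)

lemma word_op_smult:
  assumes T: "T \<in> {1..n} \<rightarrow> carrier (BO X)" and \<alpha>: "\<alpha> \<in> lists {1..n}"
  shows "word_op X (\<lambda>i. c \<odot>\<^bsub>BO X\<^esub> T i) \<alpha> = c ^ length \<alpha> \<odot>\<^bsub>BO X\<^esub> word_op X T \<alpha>"
  using \<alpha>
proof (induction \<alpha>)
  case Nil
  show ?case by (rule BO_ext) (auto simp: word_op_def smult_one [simplified])
next
  case (Cons i \<alpha>)
  have i: "T i \<in> carrier (BO X)" using T Cons by auto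
  have W: "word_op X T \<alpha> \<in> carrier (BO X)" using T Cons by (intro word_op_closed) auto
  have "word_op X (\<lambda>i. c \<odot>\<^bsub>BO X\<^esub> T i) (i # \<alpha>)
      = (c \<odot>\<^bsub>BO X\<^esub> T i) \<otimes>\<^bsub>BO X\<^esub> (c ^ length \<alpha> \<odot>\<^bsub>BO X\<^esub> word_op X T \<alpha>)"
    using Cons.IH by (simp add: word_op_def)
  also have "\<dots> = c ^ length (i # \<alpha>) \<odot>\<^bsub>BO X\<^esub> (T i \<otimes>\<^bsub>BO X\<^esub> word_op X T \<alpha>)"
    using i W by (intro BO_ext_inner) (auto simp: BO_homogeneous hinner_simps)
  finally show ?case by (simp add: word_op_def)
qed

end

section \<open>Scaling of homogeneous parts and the coefficient bound\<close>

context hilbert_tensor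
begin

lemma tensor_op_smult_left:
  assumes S: "S \<in> carrier (BO X)" and T: "T \<in> carrier (BO H)"
  shows "tensor_op X H Z t (c \<odot>\<^bsub>BO X\<^esub> S) T = c \<odot>\<^bsub>BO Z\<^esub> tensor_op X H Z t S T"
  using assms by (intro tensor_op_eqI) (auto simp: tensor_op_apply tensor_closed tensor_smult_left)

text \<open>Makes the norm of I - A_0 appear in the coefficient bound: the constant term of I - F is
  itself an elementary tensor operator.\<close>

lemma tensor_op_one_minus:
  assumes T: "T \<in> carrier (BO H)"
  shows "tensor_op X H Z t \<one>\<^bsub>BO X\<^esub> (\<one>\<^bsub>BO H\<^esub> \<ominus>\<^bsub>BO H\<^esub> T)
    = \<one>\<^bsub>BO Z\<^esub> \<ominus>\<^bsub>BO Z\<^esub> tensor_op X H Z t \<one>\<^bsub>BO X\<^esub> T"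
proof (rule tensor_op_eqI)
  fix x h assume x: "x \<in> carrier X" and h: "h \<in> carrier H"
  \<comment> \<open>Bilinearity is available for sums and scalar multiples, so the difference is
    rewritten with the scalar -1.\<close>
  have "h \<ominus>\<^bsub>H\<^esub> T h = h \<oplus>\<^bsub>H\<^esub> (- 1) \<odot>\<^bsub>H\<^esub> T h"
    using T h by (intro H.hinner_ext) (auto simp: H.hinner_simps)
  then have "t x (h \<ominus>\<^bsub>H\<^esub> T h) = t x h \<oplus>\<^bsub>Z\<^esub> (- 1) \<odot>\<^bsub>Z\<^esub> t x (T h)"
    using T x h by (simp add: tensor_add_right tensor_smult_right)
  also have "\<dots> = t x h \<ominus>\<^bsub>Z\<^esub> t x (T h)"
    using T x h by (intro Z.hinner_ext) (auto simp: Z.hinner_simps tensor_closed)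
  finally show "(\<one>\<^bsub>BO Z\<^esub> \<ominus>\<^bsub>BO Z\<^esub> tensor_op X H Z t \<one>\<^bsub>BO X\<^esub> T) (t x h)
      = t (\<one>\<^bsub>BO X\<^esub> x) ((\<one>\<^bsub>BO H\<^esub> \<ominus>\<^bsub>BO H\<^esub> T) h)"
    using T x h by (simp add: tensor_closed tensor_op_apply)
qed (use T in auto)

lemma tensor_op_word_closed:
  assumes "T \<in> {1..n} \<rightarrow> carrier (BO X)" "\<forall>\<alpha>\<in>lists {1..n}. A \<alpha> \<in> carrier (BO H)"
  shows "(\<lambda>\<alpha>. tensor_op X H Z t (word_op X T \<alpha>) (A \<alpha>)) \<in> words n k \<rightarrow> carrier (BO Z)"
proof
  fix \<alpha> assume "\<alpha> \<in> words n k"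
  then have "\<alpha> \<in> lists {1..n}" by (simp add: words_def)
  then show "tensor_op X H Z t (word_op X T \<alpha>) (A \<alpha>) \<in> carrier (BO Z)"
    using assms by (intro tensor_op_closed X.word_op_closed) auto
qed

lemma hom_part_closed:
  assumes "T \<in> {1..n} \<rightarrow> carrier (BO X)" "\<forall>\<alpha>\<in>lists {1..n}. A \<alpha> \<in> carrier (BO H)"
  shows "hom_part n X H Z t A T k \<in> carrier (BO Z)"
  unfolding hom_part_def by (intro Z.BO.finsum_closed tensor_op_word_closed assms)

text \<open>Homogeneity makes F along the complex line through \<open>T\<close> a power series in
  one variable.\<close>

lemma hom_part_smult:
  assumes T: "T \<in> {1..n} \<rightarrow> carrier (BO X)" and A: "\<forall>\<alpha>\<in>lists {1..n}. A \<alpha> \<in> carrier (BO H)"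
  shows "hom_part n X H Z t A (\<lambda>i. c \<odot>\<^bsub>BO X\<^esub> T i) k = c ^ k \<odot>\<^bsub>BO Z\<^esub> hom_part n X H Z t A T k"
proof (rule Z.BO_ext_inner)
  have cT: "(\<lambda>i. c \<odot>\<^bsub>BO X\<^esub> T i) \<in> {1..n} \<rightarrow> carrier (BO X)" using T by auto
  then show "hom_part n X H Z t A (\<lambda>i. c \<odot>\<^bsub>BO X\<^esub> T i) k \<in> carrier (BO Z)"
    using A by (rule hom_part_closed)
  show "c ^ k \<odot>\<^bsub>BO Z\<^esub> hom_part n X H Z t A T k \<in> carrier (BO Z)"
    using hom_part_closed [OF T A] by blast
  fix x y assume x: "x \<in> carrier Z" and y: "y \<in> carrier Z"
  have "tensor_op X H Z t (word_op X (\<lambda>i. c \<odot>\<^bsub>BO X\<^esub> T i) \<alpha>) (A \<alpha>)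
      = c ^ k \<odot>\<^bsub>BO Z\<^esub> tensor_op X H Z t (word_op X T \<alpha>) (A \<alpha>)" if "\<alpha> \<in> words n k" for \<alpha>
    using that T A X.word_op_smult [OF T, of \<alpha> c] X.word_op_closed [OF T, of \<alpha>]
    by (auto simp: words_def tensor_op_smult_left)
  moreover have "tensor_op X H Z t (word_op X T \<alpha>) (A \<alpha>) \<in> carrier (BO Z)" if "\<alpha> \<in> words n k" for \<alpha>
    using tensor_op_word_closed [OF T A] that by (auto simp: Pi_iff)
  ultimately have "hinner Z (hom_part n X H Z t A (\<lambda>i. c \<odot>\<^bsub>BO X\<^esub> T i) k x) y
      = c ^ k * hinner Z (hom_part n X H Z t A T k x) y"
    unfolding hom_part_def
    using Z.hinner_BO_finsum [OF tensor_op_word_closed [OF cT A] x y]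
      Z.hinner_BO_finsum [OF tensor_op_word_closed [OF T A] x y] x y
    by (simp add: sum_distrib_left Z.hinner_simps)
  then show "hinner Z (hom_part n X H Z t A (\<lambda>i. c \<odot>\<^bsub>BO X\<^esub> T i) k x) y
      = hinner Z ((c ^ k \<odot>\<^bsub>BO Z\<^esub> hom_part n X H Z t A T k) x) y"
    using x y hom_part_closed [OF T A] by (simp add: Z.hinner_simps)
qed

lemma hom_part_0:
  assumes A: "A [] \<in> carrier (BO H)"
  shows "hom_part n X H Z t A T 0 = tensor_op X H Z t \<one>\<^bsub>BO X\<^esub> (A [])"
proof -
  have "words n 0 = {[]}" by (auto simp: words_def)
  moreover have "(\<Oplus>\<^bsub>BO Z\<^esub>\<alpha>\<in>{[]}. tensor_op X H Z t (word_op X T \<alpha>) (A \<alpha>))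
      = tensor_op X H Z t (word_op X T []) (A []) \<oplus>\<^bsub>BO Z\<^esub> \<zero>\<^bsub>BO Z\<^esub>"
    using A by (subst Z.BO.finsum_insert) (auto simp: word_op_def)
  ultimately show ?thesis
    using A by (simp add: hom_part_def word_op_def)
qed

text \<open>The coefficient bound applied to z \<mapsto> I - F((z/r) T) controls P_k / r^k; undoing
  the rescaling gives the factor r^k.\<close>

lemma hom_part_Suc_bound:
  fixes A :: "nat list \<Rightarrow> 'b \<Rightarrow> 'b"
  assumes A: "\<forall>\<alpha>\<in>lists {1..n}. A \<alpha> \<in> carrier (BO H)"
    and T: "T \<in> closed_row_ball n X r" and r: "0 < r"
    and conv: "\<And>T. T \<in> open_row_ball n X \<Longrightarrow> \<exists>S. op_sums Z (hom_part n X H Z t A T) S"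
    and le: "\<And>T. T \<in> open_row_ball n X \<Longrightarrow> op_le Z (re_op Z (nc_value n X H Z t A T)) \<one>\<^bsub>BO Z\<^esub>"
    and k: "1 \<le> k"
  shows "opnorm Z (hom_part n X H Z t A T k) \<le> 2 * opnorm H (\<one>\<^bsub>BO H\<^esub> \<ominus>\<^bsub>BO H\<^esub> A []) * r ^ k"
proof -
  define d where "d = opnorm H (\<one>\<^bsub>BO H\<^esub> \<ominus>\<^bsub>BO H\<^esub> A [])"
  have A0: "A [] \<in> carrier (BO H)" using A by auto
  have d: "0 \<le> d" unfolding d_def using A0 by (intro H.opnorm_nonneg) auto
  have T': "T \<in> {1..n} \<rightarrow> carrier (BO X)" using T by (auto simp: closed_row_ball_def)
  define P where "P k = hom_part n X H Z t A T k" for k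
  have P: "P k \<in> carrier (BO Z)" for k
    unfolding P_def by (rule hom_part_closed [OF T' A])
  \<comment> \<open>The largest rescaling for which every z in the open unit disc still lands in the
    open row ball.\<close>
  define \<rho> :: complex where "\<rho> = of_real (1 / r)"
  define F where "F z = nc_value n X H Z t A (\<lambda>i. (z * \<rho>) \<odot>\<^bsub>BO X\<^esub> T i)" for z
  \<comment> \<open>Coefficients of I - F: the identity enters only the constant term, all others
    change sign.\<close>
  define G where "G k = (if k = 0 then \<one>\<^bsub>BO Z\<^esub> \<ominus>\<^bsub>BO Z\<^esub> P 0 else (- (\<rho> ^ k)) \<odot>\<^bsub>BO Z\<^esub> P k)" for k
  define V where "V z = \<one>\<^bsub>BO Z\<^esub> \<ominus>\<^bsub>BO Z\<^esub> F z" for z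
  have ball: "(\<lambda>i. (z * \<rho>) \<odot>\<^bsub>BO X\<^esub> T i) \<in> open_row_ball n X" if "cmod z < 1" for z
    using r that by (intro X.closed_row_ball_smult [OF T]) (auto simp: \<rho>_def norm_mult norm_divide)
  have F_sums: "op_sums Z (\<lambda>k. (z * \<rho>) ^ k \<odot>\<^bsub>BO Z\<^esub> P k) (F z)" if "cmod z < 1" for z
  proof -
    have eq: "hom_part n X H Z t A (\<lambda>i. (z * \<rho>) \<odot>\<^bsub>BO X\<^esub> T i) = (\<lambda>k. (z * \<rho>) ^ k \<odot>\<^bsub>BO Z\<^esub> P k)"
      unfolding P_def using hom_part_smult [OF T' A] by blast
    show ?thesis
      using Z.the_op_sums [of "\<lambda>k. (z * \<rho>) ^ k \<odot>\<^bsub>BO Z\<^esub> P k"] conv [OF ball [OF that]] P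
      unfolding F_def nc_value_def eq by blast
  qed
  have F: "F z \<in> carrier (BO Z)" if "cmod z < 1" for z
    using F_sums [OF that] by (simp add: op_sums_def)
  have "hnorm Z (G k x) \<le> 2 * d * hnorm Z x" if x: "x \<in> carrier Z" for x
  proof (rule Z.positive_real_part_coefficient_bound)
    show "G m \<in> carrier (BO Z)" for m
      using P by (auto simp: G_def)
    show "V z \<in> carrier (BO Z)" if "cmod z < 1" for z
      using F [OF that] by (simp add: V_def)
    show "0 \<le> Re (hinner Z (V z x) x)" if z: "cmod z < 1" and x: "x \<in> carrier Z" for z x
      using Z.op_le_one_re_op [OF F [OF z] _ x] le [OF ball [OF z]] F [OF z] x
      by (simp add: V_def F_def Z.hinner_simps Z.Re_hinner_self)
    show "(\<lambda>m. hinner Z (G m x) y * z ^ m) sums hinner Z (V z x) y"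
      if z: "cmod z < 1" and x: "x \<in> carrier Z" and y: "y \<in> carrier Z" for z x y
    proof -
      have "(\<lambda>m. (if m = 0 then hinner Z x y else 0) - hinner Z (((z * \<rho>) ^ m \<odot>\<^bsub>BO Z\<^esub> P m) x) y)
          sums (hinner Z x y - hinner Z (F z x) y)"
        using Z.op_sums_hinner [OF _ F_sums [OF z] x y] P
        by (intro sums_diff sums_single) blast
      moreover have "(if m = 0 then hinner Z x y else 0) - hinner Z (((z * \<rho>) ^ m \<odot>\<^bsub>BO Z\<^esub> P m) x) y
          = hinner Z (G m x) y * z ^ m" for m
        using P x y by (auto simp: G_def Z.hinner_simps power_mult_distrib)
      ultimately show ?thesis
        using F [OF z] x y by (simp add: V_def Z.hinner_simps)
    qed
    show "Re (hinner Z (G 0 x) x) \<le> d * (hnorm Z x)\<^sup>2" if x: "x \<in> carrier Z" for x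
    proof -
      \<comment> \<open>Here the cross-norm bound enters: I \<otimes> (I - A_0) has norm at most
        \<open>d\<close>, hence so does its quadratic form on unit vectors.\<close>
      let ?B = "\<one>\<^bsub>BO H\<^esub> \<ominus>\<^bsub>BO H\<^esub> A []"
      have G0: "G 0 = tensor_op X H Z t \<one>\<^bsub>BO X\<^esub> ?B"
        using A0 by (simp add: G_def P_def hom_part_0 tensor_op_one_minus)
      have B: "?B \<in> carrier (BO H)" using A0 by simp
      have "hnorm Z (G 0 x) \<le> opnorm X \<one>\<^bsub>BO X\<^esub> * d * hnorm Z x"
        unfolding G0 d_def by (rule hnorm_tensor_op_le [OF _ B x]) auto
      also have "\<dots> \<le> 1 * d * hnorm Z x"
        using x d by (intro mult_right_mono X.opnorm_one_le) auto
      finally have le_d: "hnorm Z (G 0 x) * hnorm Z x \<le> d * hnorm Z x * hnorm Z x"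
        using x by (intro mult_right_mono) auto
      have G0x: "G 0 x \<in> carrier Z"
        using x B by (simp add: G0)
      have "Re (hinner Z (G 0 x) x) \<le> hnorm Z (G 0 x) * hnorm Z x"
        using complex_Re_le_cmod Z.Cauchy_Schwarz [OF G0x x] by (rule order_trans)
      with le_d show ?thesis by (simp add: power2_eq_square mult_ac)
    qed
  qed (use k x in auto)
  moreover have "hnorm Z (G k x) = hnorm Z (P k x) / r ^ k" if "x \<in> carrier Z" for x
    using that P k r
    by (simp add: G_def Z.hnorm_smult \<rho>_def norm_power norm_divide power_divide)
  ultimately have "hnorm Z (P k x) \<le> 2 * d * r ^ k * hnorm Z x" if "x \<in> carrier Z" for x
    using that r by (simp add: field_simps)
  then show ?thesis
    using d r by (fold d_def P_def) (intro Z.opnorm_le, auto)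
qed

end

theorem theorem2p6:
  fixes n :: nat
    and H :: "'h hilbert"
    and A :: "nat list \<Rightarrow> 'h \<Rightarrow> 'h"
  assumes "n \<ge> 1"
    and "hilbert_space H"
    and "universal_holomorphic TYPE('u) n H A"
    and "op_le H \<zero>\<^bsub>BO H\<^esub> (A [])"
    and "\<forall>(X :: 'u hilbert) (Z :: ('u, 'h) tensor_carrier hilbert) t T.
           hilbert_tensor X H Z t \<and> T \<in> open_row_ball n X \<longrightarrow>
           op_le Z (re_op Z (nc_value n X H Z t A T)) \<one>\<^bsub>BO Z\<^esub>"
  shows "\<forall>(K :: 'u hilbert) (Z :: ('u, 'h) tensor_carrier hilbert) t T.
           hilbert_tensor K H Z t \<and> T \<in> closed_row_ball n K (1 / 3) \<longrightarrow>
           summable (\<lambda>k. opnorm Z (hom_part n K H Z t A T k)) \<and>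
           (\<Sum>k. opnorm Z (hom_part n K H Z t A T k))
             \<le> opnorm H (A []) + opnorm H (\<one>\<^bsub>BO H\<^esub> \<ominus>\<^bsub>BO H\<^esub> A [])"
proof (intro allI impI, elim conjE)
  fix K :: "'u hilbert" and Z :: "('u, 'h) tensor_carrier hilbert" and t T
  assume KZ: "hilbert_tensor K H Z t" and T: "T \<in> closed_row_ball n K (1 / 3)"
  interpret hilbert_tensor K H Z t by (rule KZ)
  define a where "a = opnorm H (A [])"
  define d where "d = opnorm H (\<one>\<^bsub>BO H\<^esub> \<ominus>\<^bsub>BO H\<^esub> A [])"
  define p where "p k = opnorm Z (hom_part n K H Z t A T k)" for k
  have A: "\<forall>\<alpha>\<in>lists {1..n}. A \<alpha> \<in> carrier (BO H)"
    using assms(3) by (simp add: universal_holomorphic_def)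
  have T': "T \<in> {1..n} \<rightarrow> carrier (BO K)" using T by (auto simp: closed_row_ball_def)
  have A0: "A [] \<in> carrier (BO H)" using A by auto
  have p_nonneg: "0 \<le> p k" for k
    unfolding p_def by (intro Z.opnorm_nonneg hom_part_closed T' A)
  have p0: "p 0 \<le> a"
  proof -
    have a: "0 \<le> a" unfolding a_def using A0 by (rule H.opnorm_nonneg)
    have "hnorm Z (tensor_op K H Z t \<one>\<^bsub>BO K\<^esub> (A []) x) \<le> a * hnorm Z x" if x: "x \<in> carrier Z" for x
    proof -
      have "hnorm Z (tensor_op K H Z t \<one>\<^bsub>BO K\<^esub> (A []) x) \<le> opnorm K \<one>\<^bsub>BO K\<^esub> * a * hnorm Z x"
        unfolding a_def by (rule hnorm_tensor_op_le [OF _ A0 x]) auto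
      also have "\<dots> \<le> 1 * a * hnorm Z x"
        using x a by (intro mult_right_mono X.opnorm_one_le) auto
      finally show ?thesis by simp
    qed
    then show ?thesis
      unfolding p_def hom_part_0 [of A, OF A0] using a by (intro Z.opnorm_le)
  qed
  have pk: "p k \<le> 2 * d * (1 / 3) ^ k" if "1 \<le> k" for k
    unfolding p_def d_def
    using assms(3,5) KZ that
    by (intro hom_part_Suc_bound [OF A T]) (auto simp: universal_holomorphic_def)
  \<comment> \<open>From k = 1 on the majorant has first term 2 d / 3 and ratio 1/3, so its sum is
    (2 d / 3)(3/2) = d.\<close>
  have geo: "(\<lambda>k. 2 * d * (1 / 3) ^ Suc k) sums d"
    using sums_mult [OF geometric_sums [of "1 / 3 :: real"], of "2 * d / 3"] by simp
  have "(\<lambda>k. if k = 0 then a else 2 * d * (1 / 3) ^ k) sums (d + a)"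
    using sums_Suc [of "\<lambda>k. if k = 0 then a else 2 * d * (1 / 3) ^ k" d] geo by simp
  then have bound: "summable (\<lambda>k. if k = 0 then a else 2 * d * (1 / 3) ^ k)"
      "(\<Sum>k. if k = 0 then a else 2 * d * (1 / 3) ^ k) = d + a"
    by (simp_all only: sums_iff)
  \<comment> \<open>The term k = 0 needs its own majorant, because the coefficient bound starts at k
    = 1; absolute summability then follows by comparison.\<close>
  have le: "p k \<le> (if k = 0 then a else 2 * d * (1 / 3) ^ k)" for k
    using p0 pk [of k] by auto
  have summable_p: "summable p"
    by (rule summable_comparison_test' [OF bound(1), of 0]) (use p_nonneg le in auto)
  have "suminf p \<le> d + a"
    using suminf_le [OF le summable_p bound(1)] bound(2) by simp
  with summable_p show "summable (\<lambda>k. opnorm Z (hom_part n K H Z t A T k)) \<and>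
      (\<Sum>k. opnorm Z (hom_part n K H Z t A T k))
        \<le> opnorm H (A []) + opnorm H (\<one>\<^bsub>BO H\<^esub> \<ominus>\<^bsub>BO H\<^esub> A [])"
    by (simp add: p_def [abs_def] a_def d_def add.commute)
qed

end
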